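(* Let $(\tau',\tau^\star,\tau^\circ,\tau^\natural)\in\mathbb{R}_{>0}\times\mathbb{R}_{>0}\times[0,\tau^\star]\times[0,\min\{\tau^\circ,\tau'\}]$, let $T'=(t'_k)_{k\in\mathbb{N}_0}$ and $T^\star=(t^\star_k)_{k\in\mathbb{N}_0}$ be admissible event sequences satisfying the bounds (B) given in the context, and let $\Delta$ be the corresponding operator defined in the context. Let $$\beta=\Big(\tfrac{2(\tau'+\tau^\circ)}{\pi}+\sqrt{(\tau'+\tau^\circ)\,\tau^\natural}\Big)^2$$ and, for real numbers $X,Y$, let $\Pi(X,Y)$ be the multiplication operator on $\mathbf{L}_2\times\mathbf{L}_2$ given by $$\Big(\Pi(X,Y)\begin{bmatrix} v\\ w\end{bmatrix}\Big)(t)=\begin{bmatrix}\beta X+\tau^\natural Y & Y\\ Y & -X\end{bmatrix}\begin{bmatrix} v(t)\\ w(t)\end{bmatrix},\qquad t\ge 0.$$ Then $\Delta\in\mathrm{IQC}(\Pi(X,Y))$ for every $X\ge 0$ and $Y\ge 0$; that is, $$\left\langle\begin{bmatrix} v\\ \Delta v\end{bmatrix},\Pi(X,Y)\begin{bmatrix} v\\ \Delta v\end{bmatrix}\right\rangle_{\mathbf{L}_2}\ge 0\quad\text{for all } v\in\mathbf{L}_2.$$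
   Context: $\mathbb{N}_0$ denotes the non-negative integers. $\mathbf{L}_2$ is the space of square integrable functions $\mathbb{R}_{\ge 0}\to\mathbb{R}$, with usual inner product $\langle\cdot,\cdot\rangle_{\mathbf{L}_2}$ and norm $\|\cdot\|_{\mathbf{L}_2}$ (extended componentwise to pairs). $\mathbf{L}_{2e}$ is the set of functions $f:\mathbb{R}_{\ge0}\to\mathbb{R}$ whose truncation to $[0,\tau]$ (set to zero for $t>\tau$) is in $\mathbf{L}_2$ for every $\tau>0$. IQC: for a stable (causal and $\mathbf{L}_2$-bounded) operator $\Delta:\mathbf{L}_{2e}\to\mathbf{L}_{2e}$ and a self-adjoint $\Pi$ on $\mathbf{L}_2\times\mathbf{L}_2$, $\Delta\in\mathrm{IQC}(\Pi)$ means $\left\langle\begin{bmatrix} v\\ \Delta v\end{bmatrix},\Pi\begin{bmatrix} v\\ \Delta v\end{bmatrix}\right\rangle_{\mathbf{L}_2}\ge0$ for all $v\in\mathbf{L}_2$. Admissible event sequence: $(t_k)_{k\in\mathbb{N}_0}\subset\mathbb{R}_{\ge0}$ with $t_0=0$, $t_{k+1}-t_k>0$ for all $k$, and $\lim_{k\to\infty}t_k=+\infty$. A sequence is also identified with its set of values. $T'=(t'_k)$ is the input sample event sequence and $T^\star=(t^\star_k)$ the output hold update event sequence. With $\phi_k=\min\{t : t\in T^\star\cap[t'_k,+\infty)\}$, the bounds (B) are, for all $k\in\mathbb{N}_0$: $0<t'_{k+1}-t'_k\le\tau'$; $0<t^\star_{k+1}-t^\star_k\le\tau^\star$; $\phi_k-t'_k\le\tau^\circ\le\tau^\star$;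 and $\phi_k-\max\{t : t\in T'\cap[0,\phi_k]\}\le\tau^\natural\le\min\{\tau^\circ,\tau'\}$. For $t\ge0$ let $n(t)=\max\{k\in\mathbb{N}_0 : t^\star_k\in[0,t]\}$, $p(t)=\max\{k\in\mathbb{N}_0 : t'_k\in[0,t]\}$, $q(t)=p(t^\star_{n(t)})$ and $\sigma''(t)=t-t'_{q(t)}$. Let $(\mathscr{R}_{\sigma''}v)(t)=v(t-\sigma''(t))$ (the argument equals $t'_{q(t)}\ge 0$), and let $(\mathscr{I}v)(t)=\int_0^t v(x)\,dx$. The operator $\Delta:\mathbf{L}_{2e}\to\mathbf{L}_{2e}$ is $\Delta=(\mathsf{id}-\mathscr{R}_{\sigma''})\mathscr{I}$, where $\mathsf{id}$ is the identity; i.e. $(\Delta v)(t)=(\mathscr{I}v)(t)-(\mathscr{I}v)(t'_{q(t)})$. *)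

theory Defs
  imports "HOL-Analysis.Analysis"
begin

text \<open>A signal on the half-line $[0,\infty)$ is represented by a function of type
  \<^typ>\<open>real \<Rightarrow> real\<close>; its values at negative times are irrelevant throughout.\<close>

type_synonym signal = "real \<Rightarrow> real"

definition L2 :: "signal set" where
  "L2 = {f. f \<in> borel_measurable (lebesgue_on {0..}) \<and>
            integrable (lebesgue_on {0..}) (\<lambda>t. (f t)\<^sup>2)}"

definition truncation :: "real \<Rightarrow> signal \<Rightarrow> signal" where
  "truncation \<tau> f = (\<lambda>t. if t \<le> \<tau> then f t else 0)"

definition L2e :: "signal set" where
  "L2e = {f. \<forall>\<tau>>0. truncation \<tau> f \<in> L2}"

definition L2_inner :: "signal \<Rightarrow> signal \<Rightarrow> real" where
  "L2_inner f g = (LINT t|lebesgue_on {0..}. f t * g t)"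

definition L2_norm :: "signal \<Rightarrow> real" where
  "L2_norm f = sqrt (L2_inner f f)"

definition L2_inner_pair :: "signal \<times> signal \<Rightarrow> signal \<times> signal \<Rightarrow> real" where
  "L2_inner_pair f g = L2_inner (fst f) (fst g) + L2_inner (snd f) (snd g)"

definition ae_eq :: "signal \<Rightarrow> signal \<Rightarrow> bool" where
  "ae_eq f g \<longleftrightarrow> (AE t in lebesgue_on {0..}. f t = g t)"

text \<open>Signals are functions rather than equivalence classes, so an operator on \<^const>\<open>L2e\<close>
  also has to respect equality almost everywhere.\<close>

definition L2e_operator :: "(signal \<Rightarrow> signal) \<Rightarrow> bool" where
  "L2e_operator D \<longleftrightarrow>
     (\<forall>v\<in>L2e. D v \<in> L2e) \<and>
     (\<forall>v\<in>L2e. \<forall>w\<in>L2e. ae_eq v w \<longrightarrow> ae_eq (D v) (D w))"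

definition causal :: "(signal \<Rightarrow> signal) \<Rightarrow> bool" where
  "causal D \<longleftrightarrow>
     (\<forall>\<tau>>0. \<forall>v\<in>L2e. ae_eq (truncation \<tau> (D (truncation \<tau> v))) (truncation \<tau> (D v)))"

definition L2_bounded :: "(signal \<Rightarrow> signal) \<Rightarrow> bool" where
  "L2_bounded D \<longleftrightarrow> (\<exists>c. \<forall>v\<in>L2. D v \<in> L2 \<and> L2_norm (D v) \<le> c * L2_norm v)"

definition stable :: "(signal \<Rightarrow> signal) \<Rightarrow> bool" where
  "stable D \<longleftrightarrow> L2e_operator D \<and> causal D \<and> L2_bounded D"

text \<open>An everywhere defined symmetric map on a Hilbert space is automatically linear and
  bounded, so neither property is required explicitly.\<close>

definition self_adjoint :: "(signal \<times> signal \<Rightarrow> signal \<times> signal) \<Rightarrow> bool" where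
  "self_adjoint P \<longleftrightarrow>
     (\<forall>f\<in>L2 \<times> L2. P f \<in> L2 \<times> L2) \<and>
     (\<forall>f\<in>L2 \<times> L2. \<forall>g\<in>L2 \<times> L2. L2_inner_pair f (P g) = L2_inner_pair (P f) g)"

text \<open>The standing requirements on the operator and on the multiplier are part of membership.
  They guarantee that all the integrals in the inner product exist; otherwise the default value
  of the Bochner integral could satisfy the inequality vacuously.\<close>

definition IQC :: "(signal \<times> signal \<Rightarrow> signal \<times> signal) \<Rightarrow> (signal \<Rightarrow> signal) set" where
  "IQC P = {D. stable D \<and> self_adjoint P \<and>
               (\<forall>v\<in>L2. L2_inner_pair (v, D v) (P (v, D v)) \<ge> 0)}"

definition admissible :: "(nat \<Rightarrow> real) \<Rightarrow> bool" where
  "admissible T \<longleftrightarrow>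
     (\<forall>k. 0 \<le> T k) \<and> T 0 = 0 \<and> (\<forall>k. T (Suc k) - T k > 0) \<and> filterlim T at_top sequentially"

text \<open>The set below is infinite, so \<^const>\<open>Min\<close> is not applicable; the minimum is attained
  for admissible sequences (lemma \<open>next_event_minimum\<close>).\<close>

definition next_event :: "(nat \<Rightarrow> real) \<Rightarrow> real \<Rightarrow> real" where
  "next_event T s = (LEAST t. t \<in> range T \<inter> {s..})"

definition event_bounds ::
    "real \<Rightarrow> real \<Rightarrow> real \<Rightarrow> real \<Rightarrow> (nat \<Rightarrow> real) \<Rightarrow> (nat \<Rightarrow> real) \<Rightarrow> bool" where
  "event_bounds \<tau>in \<tau>out \<tau>cross \<tau>nat Tin Tout \<longleftrightarrow>
     (\<forall>k. let \<phi> = next_event Tout (Tin k) in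
        0 < Tin (Suc k) - Tin k \<and> Tin (Suc k) - Tin k \<le> \<tau>in \<and>
        0 < Tout (Suc k) - Tout k \<and> Tout (Suc k) - Tout k \<le> \<tau>out \<and>
        \<phi> - Tin k \<le> \<tau>cross \<and> \<tau>cross \<le> \<tau>out \<and>
        \<phi> - Max (range Tin \<inter> {0..\<phi>}) \<le> \<tau>nat \<and> \<tau>nat \<le> min \<tau>cross \<tau>in)"

definition last_index :: "(nat \<Rightarrow> real) \<Rightarrow> real \<Rightarrow> nat" where
  "last_index T t = Max {k. T k \<in> {0..t}}"

lemma admissible_finite_index:
  assumes "admissible T"
  shows "finite {k. T k \<in> {0..t}}"
proof -
  have "eventually (\<lambda>k. T k > t) sequentially"
    using assms by (simp add: admissible_def filterlim_at_top_dense)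
  then obtain N where "\<And>k. k \<ge> N \<Longrightarrow> T k > t"
    by (auto simp: eventually_sequentially)
  then have "{k. T k \<in> {0..t}} \<subseteq> {..<N}"
    by (force simp: not_less[symmetric])
  then show ?thesis
    using finite_subset by blast
qed

lemma admissible_finite_events:
  assumes "admissible T"
  shows "finite (range T \<inter> {0..t})"
proof -
  have "range T \<inter> {0..t} = T ` {k. T k \<in> {0..t}}"
    by auto
  then show ?thesis
    using admissible_finite_index[OF assms] by simp
qed

lemma next_event_minimum:
  assumes "admissible T"
  shows "next_event T s \<in> range T \<inter> {s..}"
    and "t \<in> range T \<inter> {s..} \<Longrightarrow> next_event T s \<le> t"
proof -
  have "eventually (\<lambda>k. T k \<ge> s) sequentially"
    using assms by (simp add: admissible_def filterlim_at_top)
  then obtain k where k: "T k \<ge> s"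
    by (auto simp: eventually_sequentially)
  let ?A = "range T \<inter> {s..} \<inter> {0..T k}"
  have fin: "finite ?A"
    using admissible_finite_events[OF assms, of "T k"]
    by (rule rev_finite_subset) auto
  have mem: "T k \<in> ?A"
    using k assms by (auto simp: admissible_def)
  have "Min ?A \<in> ?A"
    using fin mem by (metis Min_in empty_iff)
  moreover have "Min ?A \<le> u" if "u \<in> range T \<inter> {s..}" for u
  proof (cases "u \<le> T k")
    case True
    then have "u \<in> ?A"
      using that assms by (auto simp: admissible_def)
    then show ?thesis
      using fin by simp
  next
    case False
    then show ?thesis
      using Min_le[OF fin mem] by linarith
  qed
  ultimately have *: "next_event T s = Min ?A"
    unfolding next_event_def by (intro Least_equality) blast+
  show "next_event T s \<in> range T \<inter> {s..}"
    using * \<open>Min ?A \<in> ?A\<close> by simp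
  show "next_event T s \<le> t" if "t \<in> range T \<inter> {s..}"
    using * that \<open>\<And>u. u \<in> range T \<inter> {s..} \<Longrightarrow> Min ?A \<le> u\<close> by simp
qed

definition held_index :: "(nat \<Rightarrow> real) \<Rightarrow> (nat \<Rightarrow> real) \<Rightarrow> real \<Rightarrow> nat" where
  "held_index Tin Tout t = last_index Tin (Tout (last_index Tout t))"

definition hold_delay :: "(nat \<Rightarrow> real) \<Rightarrow> (nat \<Rightarrow> real) \<Rightarrow> real \<Rightarrow> real" where
  "hold_delay Tin Tout t = t - Tin (held_index Tin Tout t)"

definition delay_op :: "(real \<Rightarrow> real) \<Rightarrow> signal \<Rightarrow> signal" where
  "delay_op \<sigma> v = (\<lambda>t. v (t - \<sigma> t))"

definition integrator :: "signal \<Rightarrow> signal" where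
  "integrator v = (\<lambda>t. LINT x|lebesgue_on {0..t}. v x)"

definition Delta :: "(nat \<Rightarrow> real) \<Rightarrow> (nat \<Rightarrow> real) \<Rightarrow> signal \<Rightarrow> signal" where
  "Delta Tin Tout v =
     (\<lambda>t. integrator v t - delay_op (hold_delay Tin Tout) (integrator v) t)"

definition beta :: "real \<Rightarrow> real \<Rightarrow> real \<Rightarrow> real" where
  "beta \<tau>in \<tau>cross \<tau>nat =
     (2 * (\<tau>in + \<tau>cross) / pi + sqrt ((\<tau>in + \<tau>cross) * \<tau>nat))\<^sup>2"

definition mult_op :: "real ^ 2 ^ 2 \<Rightarrow> signal \<times> signal \<Rightarrow> signal \<times> signal" where
  "mult_op M f = (\<lambda>t. (M *v vector [fst f t, snd f t]) $ 1,
                  \<lambda>t. (M *v vector [fst f t, snd f t]) $ 2)"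

definition multiplier ::
    "real \<Rightarrow> real \<Rightarrow> real \<Rightarrow> real \<Rightarrow> real \<Rightarrow> signal \<times> signal \<Rightarrow> signal \<times> signal" where
  "multiplier \<tau>in \<tau>cross \<tau>nat X Y =
     mult_op (vector [vector [beta \<tau>in \<tau>cross \<tau>nat * X + \<tau>nat * Y, Y],
                      vector [Y, - X]])"

end

theory Submission
  imports Defs
begin

text \<open>Let \<open>P k\<close> be the first hold update at or after the \<open>k\<close>-th sampling instant \<open>S k\<close>. The intervals
  \<open>[P k, P (k + 1))\<close> partition the half-line, and on each of them the operator is
  \<open>v \<mapsto> \<integral>\<^bsub>S k\<^esub>\<^bsup>t\<^esup> v = \<integral>\<^bsub>S k\<^esub>\<^bsup>P k\<^esup> v + \<integral>\<^bsub>P k\<^esub>\<^bsup>t\<^esup> v\<close>. If the interval is nonempty, then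
  \<open>P k - S k \<le> \<tau>nat\<close>, \<open>P (k + 1) - S k \<le> \<tau>in + \<tau>cross\<close>, and \<open>P k\<close> precedes the next sample.

  The multiplier is nonnegative because of two separate estimates. For the coefficient of \<open>X\<close>, the
  second summand is a Volterra operator of norm at most \<open>2 (\<tau>in + \<tau>cross) / \<pi>\<close>, and the first is bounded by
  Cauchy-Schwarz with constant \<open>sqrt ((\<tau>in + \<tau>cross) \<tau>nat)\<close>. For the coefficient of \<open>Y\<close>, with \<open>w\<close> the image
  of \<open>v\<close>, the integral of \<open>2 v w = (w\<^sup>2)'\<close> over a block is at least \<open>- w (P k)\<^sup>2\<close>, again controlled by
  Cauchy-Schwarz on \<open>[S k, P k)\<close>.\<close>

section \<open>Integral inequalities\<close>

text \<open>Cauchy-Schwarz for the factorisation of \<open>\<bar>u\<bar>\<close> into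
  \<open>sqrt g\<close> and \<open>\<bar>u\<bar> / sqrt g\<close> on \<open>S\<close>. If
  \<open>u\<close> is not integrable on \<open>S\<close>, the Bochner integral on the left takes its
  default value 0 and the bound is trivial.\<close>

lemma weighted_Cauchy_Schwarz:
  fixes u g :: "'a \<Rightarrow> real"
  assumes [measurable]: "u \<in> borel_measurable M" "g \<in> borel_measurable M" "S \<in> sets M"
    and pos: "\<And>x. x \<in> S \<Longrightarrow> 0 < g x"
  shows "ennreal ((LINT x:S|M. u x)\<^sup>2) \<le> (\<integral>\<^sup>+x\<in>S. ennreal (g x) \<partial>M) * (\<integral>\<^sup>+x\<in>S. ennreal ((u x)\<^sup>2 / g x) \<partial>M)"
proof -
  let ?f = "\<lambda>x. ennreal (sqrt (g x)) * indicator S x"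
  let ?h = "\<lambda>x. ennreal (\<bar>u x\<bar> / sqrt (g x)) * indicator S x"
  have "ennreal \<bar>LINT x:S|M. u x\<bar> \<le> (\<integral>\<^sup>+x. ennreal \<bar>indicator S x * u x\<bar> \<partial>M)"
  proof (cases "integrable M (\<lambda>x. indicator S x * u x)")
    case True
    then show ?thesis
      using integral_norm_bound_ennreal[OF True] by (simp add: set_lebesgue_integral_def)
  qed (simp add: set_lebesgue_integral_def not_integrable_integral_eq)
  also have "\<dots> = (\<integral>\<^sup>+x. ?f x * ?h x \<partial>M)"
    by (intro nn_integral_cong) (auto simp: indicator_def ennreal_mult'[symmetric] dest: pos)
  finally have "(ennreal \<bar>LINT x:S|M. u x\<bar>)\<^sup>2 \<le> (\<integral>\<^sup>+x. ?f x * ?h x \<partial>M)\<^sup>2"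
    by (intro power_mono) auto
  also have "\<dots> \<le> (\<integral>\<^sup>+x. (?f x)\<^sup>2 \<partial>M) * (\<integral>\<^sup>+x. (?h x)\<^sup>2 \<partial>M)"
    by (intro Cauchy_Schwarz_nn_integral) auto
  also have "(\<integral>\<^sup>+x. (?f x)\<^sup>2 \<partial>M) = (\<integral>\<^sup>+x\<in>S. ennreal (g x) \<partial>M)"
    by (intro nn_integral_cong)
       (auto simp: indicator_def ennreal_power dest!: pos)
  also have "(\<integral>\<^sup>+x. (?h x)\<^sup>2 \<partial>M) = (\<integral>\<^sup>+x\<in>S. ennreal ((u x)\<^sup>2 / g x) \<partial>M)"
    by (intro nn_integral_cong)
       (auto simp: indicator_def ennreal_power power_divide dest!: pos)
  finally show ?thesis
    by (simp add: ennreal_power)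
qed

lemma interval_Cauchy_Schwarz:
  fixes u :: "real \<Rightarrow> real"
  assumes [measurable]: "u \<in> borel_measurable borel" and "a \<le> b"
  shows "ennreal ((LINT x:{a..<b}|lborel. u x)\<^sup>2) \<le> ennreal (b - a) * (\<integral>\<^sup>+x\<in>{a..<b}. ennreal ((u x)\<^sup>2) \<partial>lborel)"
  using weighted_Cauchy_Schwarz[of u lborel "\<lambda>_. 1" "{a..<b}"] assms by simp

text \<open>Schur's test with the weight \<open>cos (c (x - a))\<close>, an extremal of the corresponding
  variational problem; this yields the sharp constant.\<close>

lemma Volterra_L2_bound:
  fixes u :: "real \<Rightarrow> real"
  assumes [measurable]: "u \<in> borel_measurable borel" and "a < b"
  shows "(\<integral>\<^sup>+t\<in>{a..<b}. ennreal ((LINT x:{a..<t}|lborel. u x)\<^sup>2) \<partial>lborel)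
    \<le> ennreal ((2 * (b - a) / pi)\<^sup>2) * (\<integral>\<^sup>+x\<in>{a..<b}. ennreal ((u x)\<^sup>2) \<partial>lborel)"
proof -
  \<comment> \<open>This frequency makes the cosine weight positive on \<open>[a, b)\<close> with
    its first zero at \<open>b\<close>; \<open>1 / c\<close> is the constant of the claim.\<close>
  define c where "c = pi / (2 * (b - a))"
  have c: "c > 0" "c * (b - a) = pi / 2"
    using \<open>a < b\<close> by (auto simp: c_def field_simps)
  define g where "g = (\<lambda>x. cos (c * (x - a)))"
  \<comment> \<open>\<open>h\<close> is the primitive of \<open>g\<close> vanishing at
    \<open>a\<close>, and \<open>- g / c\<^sup>2\<close> is a primitive of \<open>h\<close>.
    Integrating \<open>g\<close> forward from \<open>a\<close> and then backward from
    \<open>b\<close> thus reproduces \<open>g\<close> up to the factor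
    \<open>1 / c\<^sup>2\<close>.\<close>
  define h where "h = (\<lambda>x. sin (c * (x - a)) / c)"
  have [measurable]: "g \<in> borel_measurable borel" "h \<in> borel_measurable borel"
    by (auto simp: g_def h_def)
  have arg: "0 \<le> c * (x - a)" "c * (x - a) < pi / 2" if "a \<le> x" "x < b" for x
    using that c(1) mult_strict_left_mono[of "x - a" "b - a" c] unfolding c(2)[symmetric] by auto
  have g_pos: "0 < g x" if "a \<le> x" "x < b" for x
    using arg[OF that] unfolding g_def by (intro cos_gt_zero_pi) auto
  have h_nonneg: "0 \<le> h x" if "a \<le> x" "x \<le> b" for x
  proof -
    have "c * (x - a) \<le> pi / 2"
      using that c(1) mult_left_mono[of "x - a" "b - a" c] unfolding c(2)[symmetric] by auto
    then have "c * (x - a) \<le> pi"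
      using pi_gt_zero by linarith
    then show ?thesis
      using that c unfolding h_def by (intro divide_nonneg_pos sin_ge_zero mult_nonneg_nonneg) auto
  qed
  have h0: "h a = 0" and gb: "g b = 0"
    using c unfolding h_def g_def c(2) by auto
  have int_g: "(\<integral>\<^sup>+x\<in>{a..<t}. ennreal (g x) \<partial>lborel) = ennreal (h t)" if "a \<le> t" "t < b" for t
  proof -
    have "(\<integral>\<^sup>+x\<in>{a..<t}. ennreal (g x) \<partial>lborel) = (\<integral>\<^sup>+x\<in>{a..t}. ennreal (g x) \<partial>lborel)"
    proof (rule nn_integral_cong_AE)
      show "AE x in lborel. ennreal (g x) * indicator {a..<t} x = ennreal (g x) * indicator {a..t} x"
        using AE_lborel_singleton[of t] by eventually_elim (auto simp: indicator_def)
    qed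
    also have "\<dots> = ennreal (h t - h a)"
    proof (rule nn_integral_FTC_Icc)
      show "(h has_real_derivative g x) (at x)" for x
        using c(1) unfolding h_def g_def by (auto intro!: derivative_eq_intros)
      show "0 \<le> g x" if "x \<in> {a..t}" for x
        using that \<open>t < b\<close> g_pos[of x] by auto
    qed (use that in auto)
    finally show ?thesis by (simp add: h0)
  qed
  have int_h: "(\<integral>\<^sup>+t\<in>{x<..<b}. ennreal (h t) \<partial>lborel) = ennreal (g x / c\<^sup>2)" if "a \<le> x" "x < b" for x
  proof -
    have "(\<integral>\<^sup>+t\<in>{x<..<b}. ennreal (h t) \<partial>lborel) = (\<integral>\<^sup>+t\<in>{x..b}. ennreal (h t) \<partial>lborel)"
    proof (rule nn_integral_cong_AE)
      show "AE t in lborel. ennreal (h t) * indicator {x<..<b} t = ennreal (h t) * indicator {x..b} t"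
        using AE_lborel_singleton[of x] AE_lborel_singleton[of b]
        by eventually_elim (auto simp: indicator_def)
    qed
    also have "\<dots> = ennreal (- g b / c\<^sup>2 - - g x / c\<^sup>2)"
    proof (rule nn_integral_FTC_Icc)
      show "((\<lambda>x. - g x / c\<^sup>2) has_real_derivative h t) (at t)" for t
        using c(1) unfolding h_def g_def by (auto intro!: derivative_eq_intros simp: power2_eq_square)
      show "0 \<le> h t" if "t \<in> {x..b}" for t
        using that \<open>a \<le> x\<close> by (intro h_nonneg) auto
    qed (use that in auto)
    finally show ?thesis by (simp add: gb)
  qed
  \<comment> \<open>Weighted Cauchy-Schwarz on \<open>[a, t)\<close> produces the factor
    \<open>h t\<close>. The domain \<open>a \<le> x < t\<close> is written as a condition on the
    pair, so that the integrand is visibly jointly measurable for Fubini.\<close>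
  have "(\<integral>\<^sup>+t\<in>{a..<b}. ennreal ((LINT x:{a..<t}|lborel. u x)\<^sup>2) \<partial>lborel)
    \<le> (\<integral>\<^sup>+t. (\<integral>\<^sup>+x. (ennreal (h t) * indicator {a..<b} t)
          * (ennreal ((u x)\<^sup>2 / g x) * (if a \<le> x \<and> x < t then 1 else 0)) \<partial>lborel) \<partial>lborel)"
  proof (rule nn_integral_mono)
    fix t
    show "ennreal ((LINT x:{a..<t}|lborel. u x)\<^sup>2) * indicator {a..<b} t
      \<le> (\<integral>\<^sup>+x. (ennreal (h t) * indicator {a..<b} t)
          * (ennreal ((u x)\<^sup>2 / g x) * (if a \<le> x \<and> x < t then 1 else 0)) \<partial>lborel)"
    proof (cases "a \<le> t \<and> t < b")
      case True
      have "ennreal ((LINT x:{a..<t}|lborel. u x)\<^sup>2)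
        \<le> (\<integral>\<^sup>+x\<in>{a..<t}. ennreal (g x) \<partial>lborel) * (\<integral>\<^sup>+x\<in>{a..<t}. ennreal ((u x)\<^sup>2 / g x) \<partial>lborel)"
        using True by (intro weighted_Cauchy_Schwarz) (auto intro: g_pos)
      also have "\<dots> = ennreal (h t) * (\<integral>\<^sup>+x\<in>{a..<t}. ennreal ((u x)\<^sup>2 / g x) \<partial>lborel)"
        using True by (subst int_g) auto
      also have "(\<integral>\<^sup>+x\<in>{a..<t}. ennreal ((u x)\<^sup>2 / g x) \<partial>lborel)
          = (\<integral>\<^sup>+x. ennreal ((u x)\<^sup>2 / g x) * (if a \<le> x \<and> x < t then 1 else 0) \<partial>lborel)"
        by (intro nn_integral_cong) (auto simp: indicator_def)
      finally show ?thesis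
        using True by (subst nn_integral_cmult) auto
    qed (auto simp: indicator_def)
  qed
  also have "\<dots> = (\<integral>\<^sup>+x. (\<integral>\<^sup>+t. (ennreal (h t) * indicator {a..<b} t)
          * (ennreal ((u x)\<^sup>2 / g x) * (if a \<le> x \<and> x < t then 1 else 0)) \<partial>lborel) \<partial>lborel)"
    by (intro lborel_pair.Fubini') measurable
  \<comment> \<open>With the order exchanged, integrating \<open>h\<close> over
    \<open>(x, b)\<close> gives \<open>g x / c\<^sup>2\<close>, which cancels the weight in
    \<open>(u x)\<^sup>2 / g x\<close>.\<close>
  also have "\<dots> = (\<integral>\<^sup>+x. ennreal (1 / c\<^sup>2) * (ennreal ((u x)\<^sup>2) * indicator {a..<b} x) \<partial>lborel)"
  proof (rule nn_integral_cong)
    fix x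
    show "(\<integral>\<^sup>+t. (ennreal (h t) * indicator {a..<b} t)
          * (ennreal ((u x)\<^sup>2 / g x) * (if a \<le> x \<and> x < t then 1 else 0)) \<partial>lborel)
        = ennreal (1 / c\<^sup>2) * (ennreal ((u x)\<^sup>2) * indicator {a..<b} x)"
    proof (cases "a \<le> x \<and> x < b")
      case True
      have "(\<integral>\<^sup>+t. (ennreal (h t) * indicator {a..<b} t)
          * (ennreal ((u x)\<^sup>2 / g x) * (if a \<le> x \<and> x < t then 1 else 0)) \<partial>lborel)
        = (\<integral>\<^sup>+t. ennreal ((u x)\<^sup>2 / g x) * (ennreal (h t) * indicator {x<..<b} t) \<partial>lborel)"
        using True by (intro nn_integral_cong) (auto simp: indicator_def mult.commute)
      also have "\<dots> = ennreal ((u x)\<^sup>2 / g x) * ennreal (g x / c\<^sup>2)"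
        using True int_h by (subst nn_integral_cmult) auto
      also have "\<dots> = ennreal (1 / c\<^sup>2 * (u x)\<^sup>2)"
        using True g_pos[of x] c by (subst ennreal_mult'[symmetric]) auto
      finally show ?thesis
        using True by (simp add: ennreal_mult'[symmetric])
    next
      case False
      then have "(\<integral>\<^sup>+t. (ennreal (h t) * indicator {a..<b} t)
          * (ennreal ((u x)\<^sup>2 / g x) * (if a \<le> x \<and> x < t then 1 else 0)) \<partial>lborel)
        = (\<integral>\<^sup>+(t::real). 0 \<partial>lborel)"
        by (intro nn_integral_cong) (auto simp: indicator_def)
      then show ?thesis
        using False by auto
    qed
  qed
  also have "\<dots> = ennreal (1 / c\<^sup>2) * (\<integral>\<^sup>+x\<in>{a..<b}. ennreal ((u x)\<^sup>2) \<partial>lborel)"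
    by (intro nn_integral_cmult) auto
  also have "1 / c\<^sup>2 = (2 * (b - a) / pi)\<^sup>2"
    by (simp add: c_def power_divide)
  finally show ?thesis .
qed

text \<open>The square of the integral is a double integral of \<open>u x * u y\<close> over a
  square. Its two triangles contribute equally by symmetry and the diagonal is null. This replaces
  differentiation of the squared primitive, as \<open>u\<close> is merely integrable.\<close>

lemma integral_times_primitive:
  fixes u :: "real \<Rightarrow> real"
  assumes u: "set_integrable lborel {a..<b} u"
  shows "set_integrable lborel {a..<b} (\<lambda>t. u t * (LINT x:{a..<t}|lborel. u x))"
    and "2 * (LINT t:{a..<b}|lborel. u t * (LINT x:{a..<t}|lborel. u x)) = (LINT x:{a..<b}|lborel. u x)\<^sup>2"
proof -
  define f where "f = (\<lambda>x. indicator {a..<b} x * u x)"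
  have f: "integrable lborel f"
    using u by (simp add: f_def set_integrable_def)
  then have [measurable]: "f \<in> borel_measurable borel"
    by simp
  \<comment> \<open>The product restricted to the triangle \<open>x < y\<close>; integrating out
    \<open>x\<close> first yields \<open>u\<close> times its primitive.\<close>
  let ?J = "\<lambda>x y. f y * (if x < y then f x else 0)"
  have prod: "integrable (lborel \<Otimes>\<^sub>M lborel) (\<lambda>(x,y). f x * f y)"
  proof (rule lborel_pair.Fubini_integrable)
    show "AE x in lborel. integrable lborel (\<lambda>y. case (x, y) of (x, y) \<Rightarrow> f x * f y)"
      using f by simp
    show "integrable lborel (\<lambda>x. LINT y|lborel. norm (case (x, y) of (x, y) \<Rightarrow> f x * f y))"
      using f by (simp add: abs_mult)
  qed measurable
  have J: "integrable (lborel \<Otimes>\<^sub>M lborel) (\<lambda>(x,y). ?J x y)"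
    by (rule Bochner_Integration.integrable_bound[OF prod]) (auto simp: abs_mult mult.commute)
  have J_snd: "(LINT x|lborel. ?J x y) = indicator {a..<b} y *\<^sub>R (u y * (LINT x:{a..<y}|lborel. u x))" for y
  proof -
    have "(LINT x|lborel. ?J x y) = f y * (LINT x|lborel. (if x < y then f x else 0))"
      by simp
    also have "\<dots> = indicator {a..<b} y *\<^sub>R (u y * (LINT x:{a..<y}|lborel. u x))"
    proof (cases "y \<in> {a..<b}")
      case True
      then have "(LINT x|lborel. (if x < y then f x else 0)) = (LINT x:{a..<y}|lborel. u x)"
        unfolding set_lebesgue_integral_def
        by (intro Bochner_Integration.integral_cong) (auto simp: f_def indicator_def)
      with True show ?thesis
        by (simp add: f_def)
    qed (simp add: f_def)
    finally show ?thesis .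
  qed
  show "set_integrable lborel {a..<b} (\<lambda>t. u t * (LINT x:{a..<t}|lborel. u x))"
    using lborel_pair.integrable_snd[OF J] unfolding J_snd set_integrable_def .
  have "(LINT t:{a..<b}|lborel. u t * (LINT x:{a..<t}|lborel. u x)) = (LINT y|lborel. (LINT x|lborel. ?J x y))"
    unfolding J_snd set_lebesgue_integral_def ..
  also have "\<dots> = integral\<^sup>L (lborel \<Otimes>\<^sub>M lborel) (\<lambda>(x,y). ?J x y)"
    by (rule lborel_pair.integral_snd[OF J])
  finally have 1: "(LINT t:{a..<b}|lborel. u t * (LINT x:{a..<t}|lborel. u x))
      = (LINT x|lborel. (LINT y|lborel. ?J x y))"
    using lborel_pair.integral_fst[OF J] by simp
  \<comment> \<open>The same number with the bound variables renamed. Together with fact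
    \<open>1\<close> it expresses twice the integral through both triangles over a common outer
    variable.\<close>
  have 2: "(LINT t:{a..<b}|lborel. u t * (LINT x:{a..<t}|lborel. u x)) = (LINT x|lborel. (LINT y|lborel. ?J y x))"
    unfolding J_snd set_lebesgue_integral_def ..
  have "2 * (LINT t:{a..<b}|lborel. u t * (LINT x:{a..<t}|lborel. u x))
      = (LINT x|lborel. (LINT y|lborel. ?J x y)) + (LINT x|lborel. (LINT y|lborel. ?J y x))"
    using 1 2 by simp
  also have "\<dots> = (LINT x|lborel. (LINT y|lborel. ?J x y) + (LINT y|lborel. ?J y x))"
    using lborel_pair.integrable_fst[OF J] lborel_pair.integrable_snd[OF J]
    by (intro Bochner_Integration.integral_add[symmetric]) auto
  also have "\<dots> = (LINT x|lborel. (LINT y|lborel. f x * f y))"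
  proof (rule Bochner_Integration.integral_cong[OF refl])
    fix x
    have i1: "integrable lborel (\<lambda>y. ?J x y)"
      using f by (intro Bochner_Integration.integrable_bound[OF integrable_mult_right[OF f, of "f x"]]) (auto simp: abs_mult)
    have i2: "integrable lborel (\<lambda>y. ?J y x)"
      using f by (intro Bochner_Integration.integrable_bound[OF integrable_mult_right[OF f, of "f x"]]) (auto simp: abs_mult)
    have "(LINT y|lborel. ?J x y) + (LINT y|lborel. ?J y x) = (LINT y|lborel. ?J x y + ?J y x)"
      using i1 i2 by simp
    also have "\<dots> = (LINT y|lborel. f x * f y)"
    proof (rule integral_cong_AE)
      show "AE y in lborel. ?J x y + ?J y x = f x * f y"
        using AE_lborel_singleton[of x] by eventually_elim (auto simp: mult.commute)
    qed measurable
    finally show "(LINT y|lborel. ?J x y) + (LINT y|lborel. ?J y x) = (LINT y|lborel. f x * f y)" .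
  qed
  also have "\<dots> = (LINT x:{a..<b}|lborel. u x)\<^sup>2"
    by (simp add: f_def power2_eq_square set_lebesgue_integral_def)
  finally show "2 * (LINT t:{a..<b}|lborel. u t * (LINT x:{a..<t}|lborel. u x)) = (LINT x:{a..<b}|lborel. u x)\<^sup>2" .
qed

section \<open>Integrability, splitting and exhaustion of intervals\<close>

lemma square_integrable_imp_set_integrable:
  fixes u :: "real \<Rightarrow> real"
  assumes [measurable]: "u \<in> borel_measurable borel" and "integrable lborel (\<lambda>x. (u x)\<^sup>2)"
  shows "set_integrable lborel {a..<b} u"
proof -
  \<comment> \<open>A majorant, since \<open>\<bar>u x\<bar> \<le> 1 + (u x)\<^sup>2\<close>; the
    constant 1 is integrable over a bounded interval.\<close>
  have "integrable lborel (\<lambda>x. indicator {a..<b} x + (u x)\<^sup>2)"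
    using assms by (intro Bochner_Integration.integrable_add integrable_real_indicator emeasure_bounded_finite) auto
  then show ?thesis
    unfolding set_integrable_def
  proof (rule Bochner_Integration.integrable_bound)
    have "\<bar>u x\<bar> \<le> 1 + (u x)\<^sup>2" for x
    proof -
      have "0 \<le> (\<bar>u x\<bar> - 1)\<^sup>2" "0 \<le> \<bar>u x\<bar>" by auto
      then show ?thesis
        unfolding power2_diff by (simp add: algebra_simps)
    qed
    then show "AE x in lborel. norm (indicat_real {a..<b} x *\<^sub>R u x) \<le> norm (indicat_real {a..<b} x + (u x)\<^sup>2)"
      by (auto simp: indicator_def)
  qed measurable
qed

lemma set_integral_split:
  fixes u :: "real \<Rightarrow> real"
  assumes "a \<le> b" "b \<le> c" "set_integrable lborel {a..<c} u"
  shows "(LINT x:{a..<c}|lborel. u x) = (LINT x:{a..<b}|lborel. u x) + (LINT x:{b..<c}|lborel. u x)"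
proof -
  have "{a..<c} = {a..<b} \<union> {b..<c}"
    using assms by auto
  moreover have "set_integrable lborel {a..<b} u" "set_integrable lborel {b..<c} u"
    using assms by (auto intro: set_integrable_subset)
  ultimately show ?thesis
    by (simp add: set_integral_Un)
qed

lemma nn_set_integral_split:
  fixes f :: "real \<Rightarrow> ennreal"
  assumes [measurable]: "f \<in> borel_measurable borel" and "a \<le> b" "b \<le> c"
  shows "(\<integral>\<^sup>+x\<in>{a..<c}. f x \<partial>lborel) = (\<integral>\<^sup>+x\<in>{a..<b}. f x \<partial>lborel) + (\<integral>\<^sup>+x\<in>{b..<c}. f x \<partial>lborel)"
  using assms by (subst nn_integral_add[symmetric]) (auto intro!: nn_integral_cong simp: indicator_def)

lemma UN_half_open_intervals:
  fixes P :: "nat \<Rightarrow> real"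
  assumes "filterlim P at_top sequentially"
  shows "(\<Union>n. {a..<P n}) = {a..}"
proof safe
  fix x assume "x \<ge> a"
  moreover from assms obtain n where "x < P n"
    by (auto simp: filterlim_at_top_dense eventually_sequentially)
  ultimately show "x \<in> (\<Union>n. {a..<P n})" by auto
qed auto

text \<open>Continuity from below of the measure with density \<open>f\<close>. It lets bounds
  obtained at the block ends \<open>P n\<close> pass to the whole half-line.\<close>

lemma nn_set_integral_half_line_le:
  fixes f :: "real \<Rightarrow> ennreal" and P :: "nat \<Rightarrow> real"
  assumes [measurable]: "f \<in> borel_measurable borel"
    and "incseq P" "filterlim P at_top sequentially"
    and le: "\<And>n. (\<integral>\<^sup>+x\<in>{a..<P n}. f x \<partial>lborel) \<le> C"
  shows "(\<integral>\<^sup>+x\<in>{a..}. f x \<partial>lborel) \<le> C"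
proof -
  have "(\<integral>\<^sup>+x\<in>{a..}. f x \<partial>lborel) = emeasure (density lborel f) (\<Union>n. {a..<P n})"
    by (simp add: emeasure_density UN_half_open_intervals[OF assms(3)])
  also have "\<dots> = (SUP n. emeasure (density lborel f) {a..<P n})"
    using \<open>incseq P\<close>
    by (intro SUP_emeasure_incseq[symmetric]) (auto simp: incseq_def intro: order_less_le_trans)
  also have "\<dots> \<le> C"
    using le by (intro SUP_least) (simp add: emeasure_density)
  finally show ?thesis .
qed

text \<open>For \<open>B = 0\<close> the quotient \<open>y\<^sup>2 / B\<close> is \<open>0\<close>, which is why \<open>y = 0\<close> is needed.\<close>

lemma power2_add_le_weighted:
  fixes x y A B :: real
  assumes "0 < A" "0 \<le> B" "B = 0 \<Longrightarrow> y = 0"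
  shows "(x + y)\<^sup>2 \<le> (A + B) / A * x\<^sup>2 + (A + B) / B * y\<^sup>2"
proof (cases "B = 0")
  case False
  then have "0 < B" using assms by simp
  have "(A + B) / A * x\<^sup>2 + (A + B) / B * y\<^sup>2 - (x + y)\<^sup>2 = (B * x - A * y)\<^sup>2 / (A * B)"
    using \<open>0 < A\<close> \<open>0 < B\<close> by (simp add: field_simps power2_eq_square)
  also have "\<dots> \<ge> 0"
    using \<open>0 < A\<close> \<open>0 < B\<close> by simp
  finally show ?thesis by simp
qed (use assms in auto)

section \<open>Estimates on a single block\<close>

lemma borel_measurable_primitive:
  fixes u :: "real \<Rightarrow> real"
  assumes [measurable]: "u \<in> borel_measurable borel"
  shows "(\<lambda>t. LINT x:{a..<t}|lborel. u x) \<in> borel_measurable borel"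
proof -
  have "(\<lambda>t. LINT x|lborel. (if a \<le> x \<and> x < t then u x else 0)) \<in> borel_measurable borel"
    by measurable
  also have "(\<lambda>t. LINT x|lborel. (if a \<le> x \<and> x < t then u x else 0)) = (\<lambda>t. LINT x:{a..<t}|lborel. u x)"
    unfolding set_lebesgue_integral_def
    by (intro ext Bochner_Integration.integral_cong) (auto simp: indicator_def)
  finally show ?thesis .
qed

text \<open>The integral from \<open>s\<close> is the Volterra part from \<open>a\<close> plus a
  constant \<open>y\<close>. The weights \<open>(A + B) / A\<close> and \<open>(A + B) / B\<close>
  are chosen so that, after the bounds with \<open>A\<^sup>2\<close> and \<open>B\<^sup>2\<close>, a
  common factor \<open>A + B\<close> comes out. The energies on \<open>[a, b)\<close> and
  \<open>[s, a)\<close> stay separate because they are summed over two different families of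
  disjoint intervals.\<close>

lemma block_gain:
  fixes u :: "real \<Rightarrow> real"
  assumes [measurable]: "u \<in> borel_measurable borel"
    and u: "set_integrable lborel {s..<b} u"
    and "s \<le> a" "a < b" "a - s \<le> h" "b - s \<le> L"
  defines "A \<equiv> 2 * L / pi" and "B \<equiv> sqrt (L * h)"
  shows "(\<integral>\<^sup>+t\<in>{a..<b}. ennreal ((LINT x:{s..<t}|lborel. u x)\<^sup>2) \<partial>lborel)
    \<le> ennreal (A + B) * (ennreal A * (\<integral>\<^sup>+x\<in>{a..<b}. ennreal ((u x)\<^sup>2) \<partial>lborel)
        + ennreal B * (\<integral>\<^sup>+x\<in>{s..<a}. ennreal ((u x)\<^sup>2) \<partial>lborel))"
proof -
  have pos: "0 < L" "0 \<le> h" "0 < A" "0 \<le> B"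
    using assms by auto
  define y where "y = (LINT x:{s..<a}|lborel. u x)"
  let ?U = "\<lambda>a b. (\<integral>\<^sup>+x\<in>{a..<b}. ennreal ((u x)\<^sup>2) \<partial>lborel)"
  let ?w = "\<lambda>t. (LINT x:{a..<t}|lborel. u x)"
  \<comment> \<open>Since \<open>L > 0\<close>, this case forces \<open>h = 0\<close>, so the window
    \<open>[s, a)\<close> is empty.\<close>
  have B0: "y = 0" if "B = 0"
  proof -
    have "s = a" using that pos assms by (auto simp: B_def)
    then show ?thesis by (simp add: y_def set_lebesgue_integral_def)
  qed
  note borel_measurable_primitive[measurable]
  have "(\<integral>\<^sup>+t\<in>{a..<b}. ennreal ((LINT x:{s..<t}|lborel. u x)\<^sup>2) \<partial>lborel)
    \<le> (\<integral>\<^sup>+t. ennreal ((A + B) / A) * (ennreal ((?w t)\<^sup>2) * indicator {a..<b} t)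
        + ennreal ((A + B) / B * y\<^sup>2) * indicator {a..<b} t \<partial>lborel)"
  proof (rule nn_integral_mono)
    fix t
    show "ennreal ((LINT x:{s..<t}|lborel. u x)\<^sup>2) * indicator {a..<b} t
      \<le> ennreal ((A + B) / A) * (ennreal ((?w t)\<^sup>2) * indicator {a..<b} t)
        + ennreal ((A + B) / B * y\<^sup>2) * indicator {a..<b} t"
    proof (cases "t \<in> {a..<b}")
      case True
      then have "(LINT x:{s..<t}|lborel. u x) = ?w t + y"
        using \<open>s \<le> a\<close> set_integral_split[of s a t u] set_integrable_subset[OF u, of "{s..<t}"]
        by (auto simp: y_def)
      then show ?thesis
        using True pos power2_add_le_weighted[of A B y "?w t"] B0
        by (auto simp: ennreal_mult'[symmetric] ennreal_plus[symmetric] simp del: ennreal_plus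
            intro!: ennreal_leI)
    qed auto
  qed
  also have "\<dots> = ennreal ((A + B) / A) * (\<integral>\<^sup>+t\<in>{a..<b}. ennreal ((?w t)\<^sup>2) \<partial>lborel)
      + ennreal ((A + B) / B * y\<^sup>2) * ennreal (b - a)"
    using \<open>a < b\<close> by (subst nn_integral_add) (auto simp: nn_integral_cmult nn_integral_cmult_indicator)
  also have "\<dots> \<le> ennreal ((A + B) / A) * (ennreal (A\<^sup>2) * ?U a b)
      + ennreal ((A + B) / B) * (ennreal (B\<^sup>2) * ?U s a)"
  proof (rule add_mono)
    have "(2 * (b - a) / pi)\<^sup>2 \<le> A\<^sup>2"
      unfolding A_def using assms(3-6) by (intro power_mono divide_right_mono) auto
    then have "(\<integral>\<^sup>+t\<in>{a..<b}. ennreal ((?w t)\<^sup>2) \<partial>lborel) \<le> ennreal (A\<^sup>2) * ?U a b"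
      using \<open>a < b\<close>
      by (intro order_trans[OF Volterra_L2_bound[of u a b]] mult_right_mono ennreal_leI) auto
    then show "ennreal ((A + B) / A) * (\<integral>\<^sup>+t\<in>{a..<b}. ennreal ((?w t)\<^sup>2) \<partial>lborel)
        \<le> ennreal ((A + B) / A) * (ennreal (A\<^sup>2) * ?U a b)"
      by (intro mult_left_mono) auto
    \<comment> \<open>One factor \<open>b - a \<le> L\<close> comes from integrating the constant
      over the block, the other \<open>a - s \<le> h\<close> from Cauchy-Schwarz on the
      window.\<close>
    have le: "(b - a) * (a - s) \<le> B\<^sup>2"
      unfolding B_def using assms(3-6) pos by (auto intro!: mult_mono)
    have "ennreal ((A + B) / B * y\<^sup>2) * ennreal (b - a) = ennreal ((A + B) / B) * (ennreal (b - a) * ennreal (y\<^sup>2))"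
      using pos \<open>a < b\<close> by (simp add: ennreal_mult'[symmetric] mult_ac)
    also have "\<dots> \<le> ennreal ((A + B) / B) * (ennreal (b - a) * (ennreal (a - s) * ?U s a))"
      unfolding y_def using \<open>s \<le> a\<close> by (intro mult_left_mono interval_Cauchy_Schwarz) auto
    also have "\<dots> = ennreal ((A + B) / B) * (ennreal ((b - a) * (a - s)) * ?U s a)"
      using \<open>s \<le> a\<close> \<open>a < b\<close> by (simp add: ennreal_mult mult.assoc)
    also have "\<dots> \<le> ennreal ((A + B) / B) * (ennreal (B\<^sup>2) * ?U s a)"
      using le by (intro mult_left_mono mult_right_mono ennreal_leI) auto
    finally show "ennreal ((A + B) / B * y\<^sup>2) * ennreal (b - a)
        \<le> ennreal ((A + B) / B) * (ennreal (B\<^sup>2) * ?U s a)" .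
  qed
  \<comment> \<open>For \<open>B = 0\<close> the cancellation of \<open>B\<close> is still valid:
    both forms of the second term are 0.\<close>
  also have "\<dots> = ennreal ((A + B) * A) * ?U a b + ennreal ((A + B) * B) * ?U s a"
    using pos by (simp add: mult.assoc[symmetric] ennreal_mult'[symmetric] power2_eq_square)
  also have "\<dots> = ennreal (A + B) * (ennreal A * ?U a b + ennreal B * ?U s a)"
    using pos by (simp add: distrib_left mult.assoc ennreal_mult del: ennreal_plus)
  finally show ?thesis .
qed

text \<open>With \<open>w\<close> starting at \<open>y\<close> and ending at \<open>y + I\<close>,
  the doubled integral equals \<open>(y + I)\<^sup>2 - y\<^sup>2\<close>. The end value is
  discarded, and only the initial value, accumulated on \<open>[s, a)\<close>, has to be paid
  for.\<close>

lemma block_passivity: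
  fixes u :: "real \<Rightarrow> real"
  assumes [measurable]: "u \<in> borel_measurable borel"
    and u: "set_integrable lborel {s..<b} u" and u2: "set_integrable lborel {s..<a} (\<lambda>x. (u x)\<^sup>2)"
    and "s \<le> a" "a < b" "a - s \<le> h"
  shows "2 * (LINT t:{a..<b}|lborel. u t * (LINT x:{s..<t}|lborel. u x)) \<ge> - h * (LINT x:{s..<a}|lborel. (u x)\<^sup>2)"
proof -
  define y where "y = (LINT x:{s..<a}|lborel. u x)"
  define I where "I = (LINT x:{a..<b}|lborel. u x)"
  let ?w = "\<lambda>t. (LINT x:{a..<t}|lborel. u x)"
  have u': "set_integrable lborel {a..<b} u"
    using set_integrable_subset[OF u] \<open>s \<le> a\<close> by auto
  have "(LINT t:{a..<b}|lborel. u t * (LINT x:{s..<t}|lborel. u x)) = (LINT t:{a..<b}|lborel. y * u t + u t * ?w t)"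
  proof (intro set_lebesgue_integral_cong ballI allI impI)
    fix t assume "t \<in> {a..<b}"
    then show "u t * (LINT x:{s..<t}|lborel. u x) = y * u t + u t * ?w t"
      using \<open>s \<le> a\<close> set_integral_split[of s a t u] set_integrable_subset[OF u, of "{s..<t}"]
      by (auto simp: y_def algebra_simps)
  qed simp
  also have "\<dots> = y * I + (LINT t:{a..<b}|lborel. u t * ?w t)"
    using integral_times_primitive(1)[OF u'] u'
    by (subst set_integral_add(2)) (auto simp: I_def)
  finally have "2 * (LINT t:{a..<b}|lborel. u t * (LINT x:{s..<t}|lborel. u x)) = (y + I)\<^sup>2 - y\<^sup>2"
    using integral_times_primitive(2)[OF u'] by (simp add: I_def power2_sum)
  moreover have "y\<^sup>2 \<le> h * (LINT x:{s..<a}|lborel. (u x)\<^sup>2)"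
  proof -
    have nonneg: "0 \<le> (LINT x:{s..<a}|lborel. (u x)\<^sup>2)"
      unfolding set_lebesgue_integral_def by (intro integral_nonneg_AE) auto
    have "(\<integral>\<^sup>+x\<in>{s..<a}. ennreal ((u x)\<^sup>2) \<partial>lborel) = ennreal (LINT x:{s..<a}|lborel. (u x)\<^sup>2)"
      using nn_integral_eq_integral[OF u2[unfolded set_integrable_def]]
      by (simp add: set_lebesgue_integral_def ennreal_mult' ennreal_indicator mult.commute)
    then have "ennreal (y\<^sup>2) \<le> ennreal ((a - s) * (LINT x:{s..<a}|lborel. (u x)\<^sup>2))"
      using interval_Cauchy_Schwarz[of u s a] \<open>s \<le> a\<close> by (simp add: y_def ennreal_mult')
    then have "y\<^sup>2 \<le> (a - s) * (LINT x:{s..<a}|lborel. (u x)\<^sup>2)"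
      using nonneg \<open>s \<le> a\<close> by (simp add: ennreal_le_iff)
    also have "\<dots> \<le> h * (LINT x:{s..<a}|lborel. (u x)\<^sup>2)"
      using nonneg assms by (intro mult_right_mono) auto
    finally show ?thesis .
  qed
  moreover have "0 \<le> (y + I)\<^sup>2"
    by simp
  ultimately show ?thesis
    by linarith
qed

section \<open>Summation over the hold blocks\<close>

text \<open>A block \<open>[P k, P (k + 1))\<close> is empty if the sample taken at \<open>S k\<close> is superseded before it is used.\<close>

locale hold_blocks =
  fixes S P :: "nat \<Rightarrow> real" and h L :: real
  assumes S_nonneg: "0 \<le> S k"
    and S_le_P: "S k \<le> P k"
    and incseq_S: "incseq S"
    and incseq_P: "incseq P"
    and P_0: "P 0 = 0"
    and P_at_top: "filterlim P at_top sequentially"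
    and P_less_S: "P k < P (Suc k) \<Longrightarrow> P k < S (Suc k)"
    and lag_le: "P k < P (Suc k) \<Longrightarrow> P k - S k \<le> h"
    and length_le: "P (Suc k) - S k \<le> L"
    and L_pos: "0 < L" and h_nonneg: "0 \<le> h"
begin

lemma P_nonneg: "0 \<le> P k"
  using incseq_P P_0 by (metis incseqD le0)

lemma P_Suc: "P k \<le> P (Suc k)" and S_Suc: "S k \<le> S (Suc k)"
  using incseq_P incseq_S by (auto simp: incseq_Suc_iff)

text \<open>Here \<open>u\<close> and \<open>e\<close> stand for Borel representatives of a signal
  and of its image under the sampled-data operator; \<open>e\<close> is tied to \<open>u\<close> on
  the blocks only.\<close>

context
  fixes u e :: "real \<Rightarrow> real"
  assumes u_meas [measurable]: "u \<in> borel_measurable borel"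
    and e_meas [measurable]: "e \<in> borel_measurable borel"
    and u2: "integrable lborel (\<lambda>x. (u x)\<^sup>2)"
    and e: "\<And>k t. P k \<le> t \<Longrightarrow> t < P (Suc k) \<Longrightarrow> e t = (LINT x:{S k..<t}|lborel. u x)"
begin

text \<open>The windows \<open>[S k, P k)\<close> of the nonempty blocks are pairwise disjoint, so the errors summed
  in the next two lemmas stay below multiples of the integral of \<open>u\<^sup>2\<close>.\<close>

lemma total_gain:
  "(\<integral>\<^sup>+t\<in>{0..}. ennreal ((e t)\<^sup>2) \<partial>lborel)
    \<le> ennreal ((2 * L / pi + sqrt (L * h))\<^sup>2) * (\<integral>\<^sup>+x\<in>{0..}. ennreal ((u x)\<^sup>2) \<partial>lborel)"
proof (rule nn_set_integral_half_line_le[OF _ incseq_P P_at_top])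
  define A where "A = 2 * L / pi"
  define B where "B = sqrt (L * h)"
  have AB: "0 \<le> A" "0 \<le> B"
    using L_pos h_nonneg by (auto simp: A_def B_def)
  let ?U = "\<lambda>a b. (\<integral>\<^sup>+x\<in>{a..<b}. ennreal ((u x)\<^sup>2) \<partial>lborel)"
  let ?E = "\<lambda>a b. (\<integral>\<^sup>+x\<in>{a..<b}. ennreal ((e x)\<^sup>2) \<partial>lborel)"
  have U_mono: "?U 0 a \<le> ?U 0 b" if "a \<le> b" for a b
    using that by (intro nn_integral_mono) (auto simp: indicator_def)
  \<comment> \<open>The window energy is counted only up to \<open>S n\<close>, exactly where the
    window of the next block begins, so no part of it is used twice.\<close>
  have claim: "?E 0 (P n) \<le> ennreal (A + B) * (ennreal A * ?U 0 (P n) + ennreal B * ?U 0 (S n))" for n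
  proof (induction n)
    case 0
    then show ?case by (simp add: P_0)
  next
    case (Suc n)
    show ?case
    proof (cases "P n < P (Suc n)")
      case False
      \<comment> \<open>On an empty block the left side is unchanged, while the right side can only
        grow with \<open>S\<close>.\<close>
      then have "P (Suc n) = P n"
        using P_Suc[of n] by simp
      then show ?thesis
        using Suc.IH U_mono[OF S_Suc[of n]]
        by (auto intro!: order_trans[OF Suc.IH] mult_left_mono add_left_mono)
    next
      case True
      have "?E (P n) (P (Suc n)) = (\<integral>\<^sup>+t\<in>{P n..<P (Suc n)}. ennreal ((LINT x:{S n..<t}|lborel. u x)\<^sup>2) \<partial>lborel)"
        using e by (intro nn_integral_cong) (auto simp: indicator_def)
      also have "\<dots> \<le> ennreal (A + B) * (ennreal A * ?U (P n) (P (Suc n)) + ennreal B * ?U (S n) (P n))"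
        unfolding A_def B_def
        by (intro block_gain square_integrable_imp_set_integrable u_meas u2 S_le_P lag_le length_le True)
      finally have "?E 0 (P (Suc n)) \<le> ennreal (A + B) * (ennreal A * ?U 0 (P n) + ennreal B * ?U 0 (S n))
        + ennreal (A + B) * (ennreal A * ?U (P n) (P (Suc n)) + ennreal B * ?U (S n) (P n))"
        using Suc.IH P_nonneg P_Suc
        by (subst nn_set_integral_split[of _ 0 "P n"]) (auto intro: add_mono)
      also have "\<dots> = ennreal (A + B) * (ennreal A * (?U 0 (P n) + ?U (P n) (P (Suc n)))
          + ennreal B * (?U 0 (S n) + ?U (S n) (P n)))"
        by (simp add: distrib_left add_ac del: ennreal_plus)
      also have "\<dots> = ennreal (A + B) * (ennreal A * ?U 0 (P (Suc n)) + ennreal B * ?U 0 (P n))"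
        using P_nonneg P_Suc S_nonneg S_le_P by (simp add: nn_set_integral_split[symmetric])
      \<comment> \<open>Disjointness of the windows enters here: the one just used ends at
        \<open>P n\<close>, before the next sample.\<close>
      also have "\<dots> \<le> ennreal (A + B) * (ennreal A * ?U 0 (P (Suc n)) + ennreal B * ?U 0 (S (Suc n)))"
        using P_less_S[OF True] by (intro mult_left_mono add_left_mono U_mono) auto
      finally show ?thesis .
    qed
  qed
  fix n
  let ?V = "\<integral>\<^sup>+x\<in>{0..}. ennreal ((u x)\<^sup>2) \<partial>lborel"
  have U_le: "?U 0 b \<le> ?V" for b
    by (intro nn_integral_mono) (auto simp: indicator_def)
  \<comment> \<open>Both energies are now bounded by the total one, which turns the factor into
    \<open>(A + B)\<^sup>2\<close>.\<close>
  have "?E 0 (P n) \<le> ennreal (A + B) * (ennreal A * ?V + ennreal B * ?V)"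
    by (intro order_trans[OF claim] mult_left_mono add_mono U_le) auto
  also have "\<dots> = ennreal ((A + B)\<^sup>2) * ?V"
    using AB by (simp add: power2_eq_square ennreal_mult mult.assoc distrib_right)
  finally show "?E 0 (P n) \<le> ennreal ((2 * L / pi + sqrt (L * h))\<^sup>2) * ?V"
    by (simp add: A_def B_def)
qed measurable

lemma total_passivity:
  assumes ue: "set_integrable lborel {0..} (\<lambda>t. u t * e t)"
  shows "2 * (LINT t:{0..}|lborel. u t * e t) + h * (LINT x:{0..}|lborel. (u x)\<^sup>2) \<ge> 0"
proof -
  let ?V = "\<lambda>A. (LINT x:A|lborel. (u x)\<^sup>2)"
  have u2': "set_integrable lborel A (\<lambda>x. (u x)\<^sup>2)" if "A \<in> sets borel" for A
    using that integrable_mult_indicator[of A lborel, OF _ u2] by (simp add: set_integrable_def)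
  have V_mono: "?V A \<le> ?V B" if "A \<subseteq> B" "A \<in> sets borel" "B \<in> sets borel" for A B
    unfolding set_lebesgue_integral_def
    using that u2' by (intro integral_mono) (auto simp: set_integrable_def indicator_def)
  \<comment> \<open>The same bookkeeping as for the gain: the deficit is charged to the energy
    before \<open>S n\<close>.\<close>
  have claim: "2 * (LINT t:{0..<P n}|lborel. u t * e t) \<ge> - h * ?V {0..<S n}" for n
  proof (induction n)
    case 0
    have "0 \<le> ?V {0..<S 0}"
      unfolding set_lebesgue_integral_def by (intro integral_nonneg_AE) auto
    then show ?case
      using h_nonneg by (simp add: P_0 set_lebesgue_integral_def)
  next
    case (Suc n)
    show ?case
    proof (cases "P n < P (Suc n)")
      case False
      then have "P (Suc n) = P n"
        using P_Suc[of n] by simp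
      moreover have "h * ?V {0..<S n} \<le> h * ?V {0..<S (Suc n)}"
        using S_Suc[of n] h_nonneg by (intro mult_left_mono V_mono) auto
      ultimately show ?thesis
        using Suc.IH by simp
    next
      case True
      have "(LINT t:{P n..<P (Suc n)}|lborel. u t * e t)
          = (LINT t:{P n..<P (Suc n)}|lborel. u t * (LINT x:{S n..<t}|lborel. u x))"
        using e by (intro set_lebesgue_integral_cong) auto
      then have "2 * (LINT t:{P n..<P (Suc n)}|lborel. u t * e t) \<ge> - h * ?V {S n..<P n}"
        using block_passivity[OF u_meas _ u2' S_le_P True lag_le[OF True]]
          square_integrable_imp_set_integrable[OF u_meas u2] by auto
      moreover have "(LINT t:{0..<P (Suc n)}|lborel. u t * e t)
          = (LINT t:{0..<P n}|lborel. u t * e t) + (LINT t:{P n..<P (Suc n)}|lborel. u t * e t)"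
        using P_nonneg P_Suc by (intro set_integral_split set_integrable_subset[OF ue]) auto
      moreover have "?V {0..<P n} = ?V {0..<S n} + ?V {S n..<P n}"
        using S_nonneg S_le_P by (intro set_integral_split u2') auto
      moreover have "h * ?V {0..<P n} \<le> h * ?V {0..<S (Suc n)}"
        using P_less_S[OF True] h_nonneg by (intro mult_left_mono V_mono) auto
      ultimately show ?thesis
        using Suc.IH by (simp add: algebra_simps)
    qed
  qed
  \<comment> \<open>The integrand has no fixed sign, so the limit rests on its integrability over
    the half-line, \<open>ue\<close>.\<close>
  have "(\<lambda>n. LINT t:{0..<P n}|lborel. u t * e t) \<longlonglongrightarrow> (LINT t:(\<Union>n. {0..<P n})|lborel. u t * e t)"
  proof (rule set_integral_cont_up)
    show "incseq (\<lambda>n. {0..<P n})"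
      using incseq_P by (auto simp: incseq_def intro: order_less_le_trans)
    show "set_integrable lborel (\<Union>n. {0..<P n}) (\<lambda>t. u t * e t)"
      by (rule set_integrable_subset[OF ue]) auto
  qed auto
  also have "(\<Union>n. {0..<P n}) = {0..}"
    by (rule UN_half_open_intervals[OF P_at_top])
  finally have lim: "(\<lambda>n. 2 * (LINT t:{0..<P n}|lborel. u t * e t)) \<longlonglongrightarrow> 2 * (LINT t:{0..}|lborel. u t * e t)"
    by (intro tendsto_intros)
  have "2 * (LINT t:{0..<P n}|lborel. u t * e t) \<ge> - h * ?V {0..}" for n
  proof -
    have "h * ?V {0..<S n} \<le> h * ?V {0..}"
      using h_nonneg by (intro mult_left_mono V_mono) auto
    then show ?thesis
      using claim[of n] by linarith
  qed
  then have "- h * ?V {0..} \<le> 2 * (LINT t:{0..}|lborel. u t * e t)"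
    by (intro LIMSEQ_le_const[OF lim]) auto
  then show ?thesis
    by simp
qed

end

end

section \<open>Event sequences\<close>

lemma admissible_strict_mono: "admissible T \<Longrightarrow> strict_mono T"
  by (simp add: admissible_def strict_mono_Suc_iff)

lemma admissible_incseq: "admissible T \<Longrightarrow> incseq T"
  by (simp add: admissible_strict_mono strict_mono_mono)

lemma admissible_nonneg: "admissible T \<Longrightarrow> 0 \<le> T k"
  by (simp add: admissible_def)

lemma last_index_bounds:
  assumes T: "admissible T" and "0 \<le> t"
  shows "T (last_index T t) \<le> t" and "t < T (Suc (last_index T t))"
proof -
  let ?K = "{k. T k \<in> {0..t}}"
  have fin: "finite ?K"
    by (rule admissible_finite_index[OF T])
  have "0 \<in> ?K"
    using assms by (simp add: admissible_def)
  then have "Max ?K \<in> ?K"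
    using fin by (intro Max_in) auto
  then show "T (last_index T t) \<le> t"
    by (simp add: last_index_def)
  show "t < T (Suc (last_index T t))"
  proof (rule ccontr)
    assume "\<not> t < T (Suc (last_index T t))"
    then have "Suc (last_index T t) \<in> ?K"
      using admissible_nonneg[OF T] by auto
    then show False
      using Max_ge[OF fin] by (fastforce simp: last_index_def)
  qed
qed

lemma last_index_eqI:
  assumes T: "admissible T" and "T n \<le> t" "t < T (Suc n)"
  shows "last_index T t = n"
proof -
  have "0 \<le> t"
    using admissible_nonneg[OF T, of n] assms by simp
  note b = last_index_bounds[OF T this]
  have "T (last_index T t) < T (Suc n)" "T n < T (Suc (last_index T t))"
    using b assms by linarith+
  then show ?thesis
    using admissible_strict_mono[OF T] by (auto simp: strict_mono_less)
qed

lemma last_index_mono: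
  assumes T: "admissible T" and "0 \<le> s" "s \<le> t"
  shows "last_index T s \<le> last_index T t"
proof -
  have "T (last_index T s) < T (Suc (last_index T t))"
    using last_index_bounds[OF T, of s] last_index_bounds[OF T, of t] assms by simp
  then show ?thesis
    using admissible_strict_mono[OF T] by (auto simp: strict_mono_less)
qed

lemma held_sample_bounds:
  assumes "admissible Tin" "admissible Tout" "0 \<le> t"
  shows "0 \<le> Tin (held_index Tin Tout t)" and "Tin (held_index Tin Tout t) \<le> t"
proof -
  show "0 \<le> Tin (held_index Tin Tout t)"
    by (rule admissible_nonneg[OF assms(1)])
  have "Tin (held_index Tin Tout t) \<le> Tout (last_index Tout t)"
    unfolding held_index_def
    by (rule last_index_bounds(1)[OF assms(1) admissible_nonneg[OF assms(2)]])
  also have "\<dots> \<le> t"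
    by (rule last_index_bounds(1)[OF assms(2,3)])
  finally show "Tin (held_index Tin Tout t) \<le> t" .
qed

lemma held_sample_mono:
  assumes "admissible Tin" "admissible Tout" "0 \<le> s" "s \<le> t"
  shows "Tin (held_index Tin Tout s) \<le> Tin (held_index Tin Tout t)"
proof -
  have "Tout (last_index Tout s) \<le> Tout (last_index Tout t)"
    using assms by (intro incseqD[OF admissible_incseq[OF assms(2)]] last_index_mono)
  then have "last_index Tin (Tout (last_index Tout s)) \<le> last_index Tin (Tout (last_index Tout t))"
    using assms admissible_nonneg[of Tout] by (intro last_index_mono)
  then show ?thesis
    unfolding held_index_def by (rule incseqD[OF admissible_incseq[OF assms(1)]])
qed

lemma next_event_mono:
  assumes "admissible T" "s \<le> t"
  shows "next_event T s \<le> next_event T t"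
  using next_event_minimum[OF assms(1), of t] assms by (intro next_event_minimum) auto

text \<open>The first update after sample \<open>k\<close> has occurred by time \<open>t\<close>, so
  the latest update is not older than sample \<open>k\<close>. It precedes sample
  \<open>k + 1\<close>, since otherwise the first update after that sample would also have occurred
  by \<open>t\<close>.\<close>

lemma held_index_eq:
  assumes Tin: "admissible Tin" and Tout: "admissible Tout"
    and "next_event Tout (Tin k) \<le> t" "t < next_event Tout (Tin (Suc k))"
  shows "held_index Tin Tout t = k"
  unfolding held_index_def
proof (rule last_index_eqI[OF Tin])
  obtain m where m: "next_event Tout (Tin k) = Tout m" "Tin k \<le> Tout m"
    using next_event_minimum(1)[OF Tout, of "Tin k"] by auto
  have t: "0 \<le> t"
    using m(2) admissible_nonneg[OF Tin, of k] m(1) assms(3) by simp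
  note b = last_index_bounds[OF Tout t]
  have "Tout m < Tout (Suc (last_index Tout t))"
    using m assms(3) b by simp
  then have "Tout m \<le> Tout (last_index Tout t)"
    using admissible_strict_mono[OF Tout] by (auto simp: strict_mono_less strict_mono_less_eq)
  then show "Tin k \<le> Tout (last_index Tout t)"
    using m by simp
  show "Tout (last_index Tout t) < Tin (Suc k)"
  proof (rule ccontr)
    assume "\<not> Tout (last_index Tout t) < Tin (Suc k)"
    then have "next_event Tout (Tin (Suc k)) \<le> Tout (last_index Tout t)"
      by (intro next_event_minimum(2)[OF Tout]) auto
    then show False
      using b assms(4) by simp
  qed
qed

text \<open>The length bound adds one sampling interval to the waiting time of the following sample.
  The lag bound uses that on a nonempty block the sample in use is the latest one at the
  update.\<close>

lemma event_bounds_hold_blocks: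
  assumes Tin: "admissible Tin" and Tout: "admissible Tout"
    and bounds: "event_bounds \<tau>in \<tau>out \<tau>cross \<tau>nat Tin Tout"
    and "0 < \<tau>in" "0 \<le> \<tau>cross" "0 \<le> \<tau>nat"
  shows "hold_blocks Tin (\<lambda>k. next_event Tout (Tin k)) \<tau>nat (\<tau>in + \<tau>cross)"
proof
  let ?P = "\<lambda>k. next_event Tout (Tin k)"
  have B: "Tin (Suc k) - Tin k \<le> \<tau>in" "?P k - Tin k \<le> \<tau>cross"
      "?P k - Max (range Tin \<inter> {0..?P k}) \<le> \<tau>nat" for k
    using bounds by (auto simp: event_bounds_def Let_def)
  show S_le_P: "Tin k \<le> ?P k" for k
    using next_event_minimum(1)[OF Tout, of "Tin k"] by simp
  show "0 \<le> Tin k" for k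
    by (rule admissible_nonneg[OF Tin])
  show "incseq Tin"
    by (rule admissible_incseq[OF Tin])
  then show "incseq ?P"
    by (auto simp: incseq_def intro: next_event_mono[OF Tout])
  show "?P 0 = 0"
  proof (rule antisym)
    show "?P 0 \<le> 0"
      using Tin Tout by (intro next_event_minimum(2)) (auto simp: admissible_def intro: range_eqI[of _ _ 0])
    show "0 \<le> ?P 0"
      using S_le_P[of 0] Tin by (simp add: admissible_def)
  qed
  show "filterlim ?P at_top sequentially"
    using Tin S_le_P by (auto simp: admissible_def intro: filterlim_at_top_mono always_eventually)
  \<comment> \<open>If the update at \<open>?P k\<close> came at or after sample
    \<open>k + 1\<close>, it would serve that sample too and the block would be empty.\<close>
  show P_less_S: "?P k < Tin (Suc k)" if "?P k < ?P (Suc k)" for k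
  proof (rule ccontr)
    assume "\<not> ?P k < Tin (Suc k)"
    then have "?P (Suc k) \<le> ?P k"
      using next_event_minimum(1)[OF Tout, of "Tin k"] by (intro next_event_minimum(2)[OF Tout]) auto
    with that show False by simp
  qed
  show "?P k - Tin k \<le> \<tau>nat" if "?P k < ?P (Suc k)" for k
  proof -
    have "Max (range Tin \<inter> {0..?P k}) = Tin k"
    proof (rule Max_eqI)
      show "finite (range Tin \<inter> {0..?P k})"
        by (rule admissible_finite_events[OF Tin])
      show "Tin k \<in> range Tin \<inter> {0..?P k}"
        using S_le_P admissible_nonneg[OF Tin] by auto
      fix y assume "y \<in> range Tin \<inter> {0..?P k}"
      then obtain j where j: "y = Tin j" "Tin j \<le> ?P k"
        by auto
      then have "Tin j < Tin (Suc k)"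
        using P_less_S[OF that] by simp
      then show "y \<le> Tin k"
        using j admissible_strict_mono[OF Tin] by (auto simp: strict_mono_less strict_mono_less_eq)
    qed
    then show ?thesis
      using B(3)[of k] by simp
  qed
  show "?P (Suc k) - Tin k \<le> \<tau>in + \<tau>cross" for k
    using B(1)[of k] B(2)[of "Suc k"] by simp
qed (use assms in auto)

section \<open>Square integrable signals\<close>

text \<open>Signals are only Lebesgue measurable, but Fubini's theorem is applied to \<^const>\<open>lborel\<close>,
  hence the passage to Borel representatives.\<close>

definition borel_rep :: "(real \<Rightarrow> real) \<Rightarrow> signal \<Rightarrow> bool" where
  "borel_rep u v \<longleftrightarrow> u \<in> borel_measurable borel \<and> (\<forall>x<0. u x = 0) \<and>
     v \<in> borel_measurable (lebesgue_on {0..}) \<and> (AE x in lebesgue_on {0..}. v x = u x)"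

lemma borel_rep_exists:
  assumes "v \<in> borel_measurable (lebesgue_on {0..})"
  obtains u where "borel_rep u v"
proof -
  have "(\<lambda>x. indicator {0..} x *\<^sub>R v x) \<in> borel_measurable lebesgue"
    using assms by (subst (asm) borel_measurable_restrict_space_iff) auto
  then obtain g where g: "g \<in> borel_measurable lborel" "AE x in lborel. indicator {0..} x *\<^sub>R v x = g x"
    using completion_ex_borel_measurable_real[of _ lborel] by blast
  have "AE x in lebesgue. indicator {0..} x *\<^sub>R v x = g x"
    by (rule AE_completion[OF g(2)])
  then have "AE x in lebesgue_on {0..}. v x = indicator {0..} x * g x"
    by (subst AE_restrict_space_iff) (auto simp: indicator_def elim: eventually_mono)
  then have "borel_rep (\<lambda>x. indicator {0..} x * g x) v"
    using g(1) assms by (auto simp: borel_rep_def)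
  then show ?thesis
    by (rule that)
qed

lemma AE_borel_rep:
  assumes "borel_rep u v"
  shows "AE x in lebesgue. indicator {0..} x * v x = u x"
proof -
  have "AE x in lebesgue. x \<in> {0..} \<longrightarrow> v x = u x"
    using assms unfolding borel_rep_def by (subst (asm) AE_restrict_space_iff) auto
  moreover have "u x = 0" if "x < 0" for x
    using that assms by (simp add: borel_rep_def)
  ultimately show ?thesis
    by (auto simp: indicator_def elim!: eventually_mono)
qed

text \<open>Representatives vanish at negative times, so integrals over the half-line become
  integrals over the whole line; for Borel functions the completion does not change the
  integral.\<close>

lemma borel_rep_mult:
  assumes v: "borel_rep u v" and w: "borel_rep u' v'"
  shows "integrable (lebesgue_on {0..}) (\<lambda>t. v t * v' t) \<longleftrightarrow> integrable lborel (\<lambda>x. u x * u' x)"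
    and "L2_inner v v' = (LINT x|lborel. u x * u' x)"
proof -
  have [measurable]: "u \<in> borel_measurable borel" "u' \<in> borel_measurable borel"
    using assms by (auto simp: borel_rep_def)
  have m: "(\<lambda>t. v t * v' t) \<in> borel_measurable (lebesgue_on {0..})"
    using assms by (auto simp: borel_rep_def)
  then have m1: "(\<lambda>x. indicator {0..} x *\<^sub>R (v x * v' x)) \<in> borel_measurable lebesgue"
    by (subst (asm) borel_measurable_restrict_space_iff) auto
  have m2: "(\<lambda>x. u x * u' x) \<in> borel_measurable lborel"
    by measurable
  then have m3: "(\<lambda>x. u x * u' x) \<in> borel_measurable lebesgue"
    by (rule measurable_completion)
  have ae: "AE x in lebesgue. indicator {0..} x *\<^sub>R (v x * v' x) = u x * u' x"
    using AE_borel_rep[OF v] AE_borel_rep[OF w] by eventually_elim (auto simp: indicator_def split: if_splits)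
  have "integrable (lebesgue_on {0..}) (\<lambda>t. v t * v' t) \<longleftrightarrow> integrable lebesgue (\<lambda>x. u x * u' x)"
    using integrable_cong_AE[OF m1 m3 ae] by (subst integrable_restrict_space) auto
  then show "integrable (lebesgue_on {0..}) (\<lambda>t. v t * v' t) \<longleftrightarrow> integrable lborel (\<lambda>x. u x * u' x)"
    using integrable_completion[OF m2] by simp
  have "L2_inner v v' = (LINT x|lebesgue. u x * u' x)"
    unfolding L2_inner_def using integral_cong_AE[OF m1 m3 ae]
    by (subst integral_restrict_space) auto
  then show "L2_inner v v' = (LINT x|lborel. u x * u' x)"
    using integral_completion[OF m2] by simp
qed

lemma borel_rep_L2_iff: "borel_rep u v \<Longrightarrow> v \<in> L2 \<longleftrightarrow> integrable lborel (\<lambda>x. (u x)\<^sup>2)"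
  using borel_rep_mult(1)[of u v u v] by (auto simp: L2_def borel_rep_def power2_eq_square)

text \<open>The endpoint \<open>t\<close> is a null set; half-open intervals are preferred because
  consecutive ones join without overlap.\<close>

lemma borel_rep_integrator:
  assumes v: "borel_rep u v"
  shows "integrator v t = (LINT x:{0..<t}|lborel. u x)"
proof -
  have [measurable]: "u \<in> borel_measurable borel"
    using v by (simp add: borel_rep_def)
  have "v \<in> borel_measurable (lebesgue_on {0..})"
    using v by (simp add: borel_rep_def)
  then have "(\<lambda>x. indicator {0..} x *\<^sub>R v x) \<in> borel_measurable lebesgue"
    by (subst (asm) borel_measurable_restrict_space_iff) auto
  moreover have "indicator {0..t} \<in> borel_measurable lebesgue"
    by (rule borel_measurable_indicator) simp
  ultimately have "(\<lambda>x. indicator {0..t} x *\<^sub>R (indicator {0..} x *\<^sub>R v x)) \<in> borel_measurable lebesgue"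
    by (rule borel_measurable_scaleR[rotated])
  also have "(\<lambda>x. indicator {0..t} x *\<^sub>R (indicator {0..} x *\<^sub>R v x)) = (\<lambda>x. indicator {0..t} x *\<^sub>R v x)"
    by (auto simp: indicator_def)
  finally have m1: "(\<lambda>x. indicator {0..t} x *\<^sub>R v x) \<in> borel_measurable lebesgue" .
  have m2: "(\<lambda>x. indicator {0..<t} x *\<^sub>R u x) \<in> borel_measurable lborel"
    by measurable
  then have m3: "(\<lambda>x. indicator {0..<t} x *\<^sub>R u x) \<in> borel_measurable lebesgue"
    by (rule measurable_completion)
  have ae: "AE x in lebesgue. indicator {0..t} x *\<^sub>R v x = indicator {0..<t} x *\<^sub>R u x"
    using AE_borel_rep[OF v] AE_completion[OF AE_lborel_singleton[of t]]
    by eventually_elim (auto simp: indicator_def split: if_splits)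
  have "integrator v t = (LINT x|lebesgue. indicator {0..t} x *\<^sub>R v x)"
    unfolding integrator_def by (subst integral_restrict_space) auto
  also have "\<dots> = (LINT x|lebesgue. indicator {0..<t} x *\<^sub>R u x)"
    by (rule integral_cong_AE[OF m1 m3 ae])
  also have "\<dots> = (LINT x:{0..<t}|lborel. u x)"
    using integral_completion[OF m2] by (simp add: set_lebesgue_integral_def)
  finally show ?thesis .
qed

section \<open>Algebra of square integrable signals and symmetric multipliers\<close>

lemma L2_cong:
  assumes "\<And>t. 0 \<le> t \<Longrightarrow> f t = g t"
  shows "f \<in> L2 \<longleftrightarrow> g \<in> L2"
proof -
  have "f \<in> borel_measurable (lebesgue_on {0..}) \<longleftrightarrow> g \<in> borel_measurable (lebesgue_on {0..})"
    using assms by (intro measurable_cong) (simp add: space_restrict_space)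
  moreover have "integrable (lebesgue_on {0..}) (\<lambda>t. (f t)\<^sup>2) \<longleftrightarrow> integrable (lebesgue_on {0..}) (\<lambda>t. (g t)\<^sup>2)"
    using assms by (intro Bochner_Integration.integrable_cong) (simp_all add: space_restrict_space)
  ultimately show ?thesis
    by (simp add: L2_def)
qed

lemma L2_mult_integrable:
  assumes f: "f \<in> L2" and g: "g \<in> L2"
  shows "integrable (lebesgue_on {0..}) (\<lambda>t. f t * g t)"
proof (rule Bochner_Integration.integrable_bound)
  show "integrable (lebesgue_on {0..}) (\<lambda>t. (f t)\<^sup>2 + (g t)\<^sup>2)"
    using f g by (intro Bochner_Integration.integrable_add) (auto simp: L2_def)
  show "(\<lambda>t. f t * g t) \<in> borel_measurable (lebesgue_on {0..})"
    using f g by (auto simp: L2_def)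
  have "\<bar>x * y\<bar> \<le> x\<^sup>2 + y\<^sup>2" for x y :: real
  proof -
    have "2 * \<bar>x\<bar> * \<bar>y\<bar> \<le> x\<^sup>2 + y\<^sup>2" "0 \<le> \<bar>x\<bar> * \<bar>y\<bar>"
      using sum_squares_bound[of "\<bar>x\<bar>" "\<bar>y\<bar>"] by auto
    then show ?thesis
      unfolding abs_mult by linarith
  qed
  then show "AE t in lebesgue_on {0..}. norm (f t * g t) \<le> norm ((f t)\<^sup>2 + (g t)\<^sup>2)"
    by simp
qed

lemma L2_lincomb:
  assumes f: "f \<in> L2" and g: "g \<in> L2"
  shows "(\<lambda>t. a * f t + b * g t) \<in> L2"
proof -
  have "integrable (lebesgue_on {0..}) (\<lambda>t. a\<^sup>2 * (f t)\<^sup>2 + (2 * a * b) * (f t * g t) + b\<^sup>2 * (g t)\<^sup>2)"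
    using f g L2_mult_integrable[OF f g]
    by (intro Bochner_Integration.integrable_add integrable_mult_right) (auto simp: L2_def)
  also have "(\<lambda>t. a\<^sup>2 * (f t)\<^sup>2 + (2 * a * b) * (f t * g t) + b\<^sup>2 * (g t)\<^sup>2) = (\<lambda>t. (a * f t + b * g t)\<^sup>2)"
    by (auto simp: power2_eq_square algebra_simps)
  finally show ?thesis
    using f g by (auto simp: L2_def)
qed

lemma L2_inner_commute: "L2_inner f g = L2_inner g f"
  by (simp add: L2_inner_def mult.commute)

lemma L2_inner_lincomb_right:
  assumes "f \<in> L2" "g \<in> L2" "h \<in> L2"
  shows "L2_inner f (\<lambda>t. a * g t + b * h t) = a * L2_inner f g + b * L2_inner f h"
proof -
  have "L2_inner f (\<lambda>t. a * g t + b * h t) = (LINT t|lebesgue_on {0..}. a * (f t * g t) + b * (f t * h t))"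
    by (simp add: L2_inner_def algebra_simps)
  then show ?thesis
    using assms by (simp add: L2_mult_integrable L2_inner_def)
qed

lemma L2_inner_lincomb_left:
  assumes "f \<in> L2" "g \<in> L2" "h \<in> L2"
  shows "L2_inner (\<lambda>t. a * g t + b * h t) f = a * L2_inner g f + b * L2_inner h f"
  unfolding L2_inner_commute[of "\<lambda>t. a * g t + b * h t" f] L2_inner_commute[of g f] L2_inner_commute[of h f]
  by (rule L2_inner_lincomb_right[OF assms])

lemma mult_op_2:
  "mult_op (vector [vector [a, b], vector [c, d]]) f
    = (\<lambda>t. a * fst f t + b * snd f t, \<lambda>t. c * fst f t + d * snd f t)"
  by (simp add: mult_op_def matrix_vector_mult_def sum_2 vector_2)

lemma self_adjoint_mult_op:
  "self_adjoint (mult_op (vector [vector [a, b], vector [b, d]]))"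
proof -
  let ?P = "mult_op (vector [vector [a, b], vector [b, d]])"
  have "?P (f1, f2) \<in> L2 \<times> L2" if "f1 \<in> L2" "f2 \<in> L2" for f1 f2
    using that by (simp add: mult_op_2 L2_lincomb)
  moreover have "L2_inner_pair (f1, f2) (?P (g1, g2)) = L2_inner_pair (?P (f1, f2)) (g1, g2)"
    if "f1 \<in> L2" "f2 \<in> L2" "g1 \<in> L2" "g2 \<in> L2" for f1 f2 g1 g2
    using that by (simp add: mult_op_2 L2_inner_pair_def L2_inner_lincomb_left L2_inner_lincomb_right)
  ultimately show ?thesis
    unfolding self_adjoint_def by blast
qed

lemma quadratic_form_mult_op:
  assumes "v \<in> L2" "w \<in> L2"
  shows "L2_inner_pair (v, w) (mult_op (vector [vector [a, b], vector [b, d]]) (v, w))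
    = a * L2_inner v v + 2 * b * L2_inner v w + d * L2_inner w w"
  using assms by (simp add: mult_op_2 L2_inner_pair_def L2_inner_lincomb_right L2_inner_commute[of w v])

section \<open>The sampled-data operator\<close>

lemma Delta_eq:
  "Delta Tin Tout v t = integrator v t - integrator v (Tin (held_index Tin Tout t))"
  by (simp add: Delta_def delay_op_def hold_delay_def)

lemma integrator_truncation: "t \<le> \<tau> \<Longrightarrow> integrator (truncation \<tau> v) t = integrator v t"
  unfolding integrator_def truncation_def
  by (intro Bochner_Integration.integral_cong) (auto simp: space_restrict_space)

lemma Delta_truncation:
  assumes "admissible Tin" "admissible Tout" "0 \<le> t" "t \<le> \<tau>"
  shows "Delta Tin Tout (truncation \<tau> v) t = Delta Tin Tout v t"
  using held_sample_bounds[OF assms(1-3)] assms(4) by (simp add: Delta_eq integrator_truncation)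

text \<open>Integration ignores null sets, so equality holds at every time: the truncations of both
  signals share one Borel representative and hence have the same primitive.\<close>

lemma Delta_cong_ae:
  assumes T: "admissible Tin" "admissible Tout"
    and v: "v \<in> L2e" and w: "w \<in> L2e" and ae: "ae_eq v w" and "0 \<le> t"
  shows "Delta Tin Tout v t = Delta Tin Tout w t"
proof -
  have "integrator v s = integrator w s" if "s \<le> t" for s
  proof -
    \<comment> \<open>Shifted by 1 because \<open>L2e\<close> speaks of positive truncation times
      only, and \<open>t\<close> may be 0.\<close>
    have L2: "truncation (t + 1) v \<in> L2" "truncation (t + 1) w \<in> L2"
      using v w \<open>0 \<le> t\<close> by (auto simp: L2e_def)
    then obtain u where u: "borel_rep u (truncation (t + 1) v)"
      using borel_rep_exists[of "truncation (t + 1) v"] by (auto simp: L2_def)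
    have "AE x in lebesgue_on {0..}. truncation (t + 1) v x = u x"
      using u by (simp add: borel_rep_def)
    then have "AE x in lebesgue_on {0..}. truncation (t + 1) w x = u x"
      using ae unfolding ae_eq_def by eventually_elim (auto simp: truncation_def split: if_splits)
    then have "borel_rep u (truncation (t + 1) w)"
      using u L2 by (simp add: borel_rep_def L2_def)
    then show ?thesis
      using borel_rep_integrator[OF u, of s] borel_rep_integrator[of u "truncation (t + 1) w" s] that
      by (simp add: integrator_truncation)
  qed
  then show ?thesis
    using held_sample_bounds[OF T \<open>0 \<le> t\<close>] by (simp add: Delta_eq)
qed

text \<open>The held sample never lies in the future, so the output up to \<open>\<tau>\<close>
  depends on the input up to \<open>\<tau>\<close> alone. This gives causality, and it reduces
  invariance of \<open>L2e\<close> to the action on \<open>L2\<close>.\<close>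

lemma stable_Delta:
  assumes T: "admissible Tin" "admissible Tout"
    and bdd: "L2_bounded (Delta Tin Tout)"
  shows "stable (Delta Tin Tout)"
proof -
  let ?D = "Delta Tin Tout"
  have trunc: "truncation \<tau> (?D (truncation \<tau> v)) t = truncation \<tau> (?D v) t" if "0 \<le> t" for \<tau> v t
    using Delta_truncation[OF T that] by (simp add: truncation_def)
  have causal: "causal ?D"
    unfolding causal_def ae_eq_def using trunc by (auto intro!: AE_I2)
  have "?D v \<in> L2e" if "v \<in> L2e" for v
    unfolding L2e_def
  proof safe
    fix \<tau> :: real assume "0 < \<tau>"
    then have "?D (truncation \<tau> v) \<in> L2"
      using that bdd by (auto simp: L2_bounded_def L2e_def)
    then have D: "?D (truncation \<tau> v) \<in> borel_measurable (lebesgue_on {0..})"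
        "integrable (lebesgue_on {0..}) (\<lambda>t. (?D (truncation \<tau> v) t)\<^sup>2)"
      by (auto simp: L2_def)
    have [measurable]: "{..\<tau>} \<in> sets lebesgue"
      by simp
    have ind: "indicator {..\<tau>} \<in> borel_measurable (lebesgue_on {0..})"
      by (intro measurable_restrict_space1) measurable
    have eq: "truncation \<tau> (?D v) t = indicator {..\<tau>} t * ?D (truncation \<tau> v) t" if "0 \<le> t" for t
      using trunc[OF that, of \<tau> v] by (auto simp: truncation_def indicator_def)
    have m: "(\<lambda>t. indicator {..\<tau>} t * ?D (truncation \<tau> v) t) \<in> borel_measurable (lebesgue_on {0..})"
      using ind D(1) by (rule borel_measurable_times)
    have "integrable (lebesgue_on {0..}) (\<lambda>t. (indicator {..\<tau>} t * ?D (truncation \<tau> v) t)\<^sup>2)"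
      using m by (intro Bochner_Integration.integrable_bound[OF D(2)]) (auto simp: indicator_def)
    with m have "(\<lambda>t. indicator {..\<tau>} t * ?D (truncation \<tau> v) t) \<in> L2"
      by (simp add: L2_def)
    then show "truncation \<tau> (?D v) \<in> L2"
      using L2_cong[OF eq] by simp
  qed
  moreover have "ae_eq (?D v) (?D w)" if "v \<in> L2e" "w \<in> L2e" "ae_eq v w" for v w
    unfolding ae_eq_def using Delta_cong_ae[OF T that] by (auto intro!: AE_I2)
  ultimately show ?thesis
    using causal bdd by (auto simp: stable_def L2e_operator_def)
qed

text \<open>The held sampling instant is monotone in time and therefore Borel measurable, so
  composing it with the primitive \<open>W\<close> gives a Borel function.\<close>

lemma borel_rep_Delta:
  assumes T: "admissible Tin" "admissible Tout" and v: "borel_rep u v"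
    and u2: "integrable lborel (\<lambda>x. (u x)\<^sup>2)"
  obtains e where "borel_rep e (Delta Tin Tout v)"
    "\<And>t. 0 \<le> t \<Longrightarrow> e t = (LINT x:{Tin (held_index Tin Tout t)..<t}|lborel. u x)"
proof -
  \<comment> \<open>The value 0 at negative times keeps \<open>s\<close> monotone on the whole line,
    as sampling instants are nonnegative.\<close>
  define s where "s = (\<lambda>t. if 0 \<le> t then Tin (held_index Tin Tout t) else 0)"
  have "mono s"
    unfolding s_def mono_def using held_sample_mono[OF T] held_sample_bounds[OF T] by auto
  then have [measurable]: "s \<in> borel_measurable borel"
    by (rule borel_measurable_mono)
  have u [measurable]: "u \<in> borel_measurable borel"
    using v by (simp add: borel_rep_def)
  define W where "W = (\<lambda>t. LINT x:{0..<t}|lborel. u x)"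
  have [measurable]: "W \<in> borel_measurable borel"
    unfolding W_def by (rule borel_measurable_primitive[OF u])
  define e where "e = (\<lambda>t. if 0 \<le> t then W t - W (s t) else 0)"
  have e_meas [measurable]: "e \<in> borel_measurable borel"
    unfolding e_def by measurable
  have De: "Delta Tin Tout v t = e t" if "0 \<le> t" for t
    using that by (simp add: Delta_eq borel_rep_integrator[OF v] e_def W_def s_def)
  have "e \<in> borel_measurable (lebesgue_on {0..})"
    by (intro measurable_restrict_space1 measurable_completion) simp
  then have "Delta Tin Tout v \<in> borel_measurable (lebesgue_on {0..})"
    by (rule measurable_cong[THEN iffD1, rotated]) (simp add: De space_restrict_space)
  then have "borel_rep e (Delta Tin Tout v)"
    using De by (auto simp: borel_rep_def e_def intro!: AE_I2)
  moreover have "e t = (LINT x:{Tin (held_index Tin Tout t)..<t}|lborel. u x)" if "0 \<le> t" for t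
    using set_integral_split[of 0 "s t" t u] held_sample_bounds[OF T that] that
      square_integrable_imp_set_integrable[OF u u2]
    by (simp add: e_def W_def s_def)
  ultimately show ?thesis
    by (rule that)
qed

theorem theorem1:
  fixes \<tau>in \<tau>out \<tau>cross \<tau>nat X Y :: real and Tin Tout :: "nat \<Rightarrow> real"
  assumes "0 < \<tau>in"
    and "0 < \<tau>out"
    and "\<tau>cross \<in> {0..\<tau>out}"
    and "\<tau>nat \<in> {0..min \<tau>cross \<tau>in}"
    and "admissible Tin"
    and "admissible Tout"
    and "event_bounds \<tau>in \<tau>out \<tau>cross \<tau>nat Tin Tout"
    and "X \<ge> 0"
    and "Y \<ge> 0"
  shows "Delta Tin Tout \<in> IQC (multiplier \<tau>in \<tau>cross \<tau>nat X Y)"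
proof -
  note T = \<open>admissible Tin\<close> \<open>admissible Tout\<close>
  interpret hold_blocks Tin "\<lambda>k. next_event Tout (Tin k)" \<tau>nat "\<tau>in + \<tau>cross"
    using assms by (intro event_bounds_hold_blocks) auto
  let ?D = "Delta Tin Tout"
  define \<gamma> where "\<gamma> = 2 * (\<tau>in + \<tau>cross) / pi + sqrt ((\<tau>in + \<tau>cross) * \<tau>nat)"
  have \<gamma>: "0 \<le> \<gamma>" "beta \<tau>in \<tau>cross \<tau>nat = \<gamma>\<^sup>2"
    using L_pos h_nonneg by (auto simp: \<gamma>_def beta_def)
  \<comment> \<open>The two inequalities are the parts of the quadratic form multiplied by
    \<open>X\<close> and by \<open>Y\<close>; the first also yields boundedness with gain
    \<open>\<gamma>\<close>.\<close>
  have main: "?D v \<in> L2 \<and> L2_inner (?D v) (?D v) \<le> \<gamma>\<^sup>2 * L2_inner v v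
      \<and> 0 \<le> 2 * L2_inner v (?D v) + \<tau>nat * L2_inner v v" if v: "v \<in> L2" for v
  proof -
    obtain u where u: "borel_rep u v"
      using v borel_rep_exists[of v] by (auto simp: L2_def)
    have u_meas [measurable]: "u \<in> borel_measurable borel" and u0: "\<And>x. x < 0 \<Longrightarrow> u x = 0"
      using u by (auto simp: borel_rep_def)
    have u2: "integrable lborel (\<lambda>x. (u x)\<^sup>2)"
      using v borel_rep_L2_iff[OF u] by simp
    obtain e where e: "borel_rep e (?D v)"
      and e_eq: "\<And>t. 0 \<le> t \<Longrightarrow> e t = (LINT x:{Tin (held_index Tin Tout t)..<t}|lborel. u x)"
      using borel_rep_Delta[OF T u u2] by blast
    have e_meas [measurable]: "e \<in> borel_measurable borel" and e0: "\<And>x. x < 0 \<Longrightarrow> e x = 0"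
      using e by (auto simp: borel_rep_def)
    have block: "e t = (LINT x:{Tin k..<t}|lborel. u x)"
      if "next_event Tout (Tin k) \<le> t" "t < next_event Tout (Tin (Suc k))" for k t
      using e_eq[of t] held_index_eq[OF T that] S_nonneg[of k] S_le_P[of k] that(1) by simp
    have half_line: "(\<integral>\<^sup>+x\<in>{0..}. ennreal ((f x)\<^sup>2) \<partial>lborel) = (\<integral>\<^sup>+x. ennreal ((f x)\<^sup>2) \<partial>lborel)"
      if "\<And>x. x < 0 \<Longrightarrow> f x = 0" for f :: "real \<Rightarrow> real"
      using that by (intro nn_integral_cong) (auto simp: indicator_def)
    have gain: "(\<integral>\<^sup>+x. ennreal ((e x)\<^sup>2) \<partial>lborel) \<le> ennreal (\<gamma>\<^sup>2 * (LINT x|lborel. (u x)\<^sup>2))"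
      using total_gain[OF u_meas e_meas u2 block] nn_integral_eq_integral[OF u2]
      by (simp add: half_line u0 e0 \<gamma>_def ennreal_mult')
    \<comment> \<open>The gain bound was proved for nonnegative integrals; its finiteness now
      supplies the integrability needed before inner products with the image are meaningful.\<close>
    then have e2: "integrable lborel (\<lambda>x. (e x)\<^sup>2)"
      by (intro integrableI_bounded) (auto intro: le_less_trans)
    have D: "?D v \<in> L2"
      using e2 borel_rep_L2_iff[OF e] by simp
    have "L2_inner (?D v) (?D v) \<le> \<gamma>\<^sup>2 * L2_inner v v"
      using gain nn_integral_eq_integral[OF e2] borel_rep_mult(2)[OF e e] borel_rep_mult(2)[OF u u]
      by (simp add: power2_eq_square[symmetric] ennreal_le_iff)
    moreover have "0 \<le> 2 * L2_inner v (?D v) + \<tau>nat * L2_inner v v"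
    proof -
      have ue: "integrable lborel (\<lambda>x. u x * e x)"
        using L2_mult_integrable[OF v D] borel_rep_mult(1)[OF u e] by simp
      have restrict: "(LINT x:{0..}|lborel. u x * f x) = (LINT x|lborel. u x * f x)" for f :: "real \<Rightarrow> real"
        unfolding set_lebesgue_integral_def
        using u0 by (intro Bochner_Integration.integral_cong) (auto simp: indicator_def)
      have "set_integrable lborel {0..} (\<lambda>x. u x * e x)"
        unfolding set_integrable_def using integrable_mult_indicator[OF _ ue, of "{0..}"] by simp
      from total_passivity[OF u_meas e_meas u2 block this] show ?thesis
        using borel_rep_mult(2)[OF u e] borel_rep_mult(2)[OF u u]
        by (simp add: restrict power2_eq_square)
    qed
    ultimately show ?thesis
      using D by simp
  qed
  have "L2_bounded ?D"
    unfolding L2_bounded_def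
  proof (intro exI[of _ \<gamma>] ballI conjI)
    fix v assume "v \<in> L2"
    from main[OF this] show "?D v \<in> L2" "L2_norm (?D v) \<le> \<gamma> * L2_norm v"
      using \<gamma>(1) real_sqrt_le_mono[of "L2_inner (?D v) (?D v)" "\<gamma>\<^sup>2 * L2_inner v v"]
      by (auto simp: L2_norm_def real_sqrt_mult)
  qed
  then have "stable ?D"
    by (rule stable_Delta[OF T])
  moreover have "0 \<le> L2_inner_pair (v, ?D v) (multiplier \<tau>in \<tau>cross \<tau>nat X Y (v, ?D v))"
    if "v \<in> L2" for v
  proof -
    \<comment> \<open>The quadratic form regrouped by multiplier parameter: a nonnegative
      combination of the gain and passivity inequalities.\<close>
    have "0 \<le> X * (\<gamma>\<^sup>2 * L2_inner v v - L2_inner (?D v) (?D v))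
        + Y * (2 * L2_inner v (?D v) + \<tau>nat * L2_inner v v)"
      using main[OF that] \<open>X \<ge> 0\<close> \<open>Y \<ge> 0\<close> by simp
    then show ?thesis
      using main[OF that] that
      by (simp add: multiplier_def quadratic_form_mult_op \<gamma>(2) algebra_simps)
  qed
  ultimately show ?thesis
    by (simp add: IQC_def multiplier_def self_adjoint_mult_op)
qed

end
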